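(* Let $(X,\rho)$ be a compact metric space, let $\mu_1,\mu_2$ be two continuous (non-atomic) Borel probability measures on $X$, and put $\mu=\mu_1$. Let $S:(X,\mu_1)\to(X,\mu_2)$ be a measure-preserving isomorphism (mod $0$), and let $f(x,y)=\rho(x,Sy)$ be the corresponding shifted metric, a nonnegative measurable function on $(X\times X,\mu\times\mu)$. Let $$k=\inf_L\int_{X\times X} f(x_1,x_2)\,dL(x_1,x_2),$$ where $L$ runs over all Borel probability measures on $X\times X$ with both marginals equal to $\mu$ (equivalently, $k=\inf_{L'}\int\rho\,dL'$ over all Borel probability measures $L'$ on $X\times X$ with marginals $\mu_1$ and $\mu_2$). Let $D^s_f$ be the symmetric matrix distribution of $f$, a probability measure on the space $M_\infty(\mathbb R)$ of infinite real matrices $r=\{r_{i,j}\}_{i,j=1}^\infty$, and for $n\ge 1$ let $$k_n(r)=\inf_{l}\ \frac1n\sum_{i,j=1}^n l_{i,j}\,r_{i,j},$$ where the infimum is over all bistochastic $n\times n$ matrices $l=\{l_{i,j}\}_{i,j=1}^n$. Then $k_n(r)\to k$ in measure $D^s_f$ as $n\to\infty$, i.e., for every $\varepsilon>0$, $$\lim_{n\to\infty}D^s_f\{r\in M_\infty(\mathbb R):\ |k_n(r)-k|>\varepsilon\}=0 .$$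
   Context: A measure-preserving isomorphism (mod $0$) $S:(X,\mu_1)\to(X,\mu_2)$ is a measurable map that is a bijection between sets of full measure, with measurable inverse, and satisfies $S_*\mu_1=\mu_2$; thus $f$ is defined up to null sets, and the integrals $\int f\,dL$ do not depend on this ambiguity since the marginals of $L$ equal $\mu$. Symmetric matrix distribution: let $X^\infty$ be the product of countably many copies of $X$ with the product measure $\mu^\infty$, and let $M_\infty(\mathbb R)$ be the set of all (not necessarily symmetric) infinite real matrices indexed by $\{1,2,\dots\}^2$, with the product $\sigma$-algebra. Define $F_f:X^\infty\to M_\infty(\mathbb R)$ by $F_f(x)=\{f(x_i,x_j)\}_{i,j=1}^\infty$ for $x=(x_1,x_2,\dots)$. Then $D^s_f$ is the image of $\mu^\infty$ under $F_f$, i.e., the law of the random matrix $\{f(x_i,x_j)\}_{i,j}$ with $x_1,x_2,\dots$ i.i.d. with law $\mu$. A matrix $l=\{l_{i,j}\}_{i,j=1}^n$ is bistochastic if $l_{i,j}\ge 0$ for all $i,j$, $\sum_{i=1}^n l_{i,j}=1$ for each $j$, and $\sum_{j=1}^n l_{i,j}=1$ for each $i$. *)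

theory Defs
  imports "HOL-Probability.Probability"
begin

text \<open>
  The map is a total measurable representative of its class mod 0; on the full-measure sets
  \<open>A\<close> and \<open>B\<close> it is a bijection with measurable inverse.
\<close>

definition mod0_isomorphism :: "'a measure \<Rightarrow> 'b measure \<Rightarrow> ('a \<Rightarrow> 'b) \<Rightarrow> bool" where
  "mod0_isomorphism M N S \<longleftrightarrow>
     S \<in> measurable M N \<and>
     (\<exists>A\<in>sets M. \<exists>B\<in>sets N.
        space M - A \<in> null_sets M \<and> space N - B \<in> null_sets N \<and>
        bij_betw S A B \<and>
        the_inv_into A S \<in> measurable (restrict_space N B) (restrict_space M A)) \<and>
     distr M N S = N"

definition shifted_metric :: "('a \<Rightarrow> 'a) \<Rightarrow> 'a::metric_space \<times> 'a \<Rightarrow> real" where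
  "shifted_metric S = (\<lambda>(x, y). dist x (S y))"

definition couplings ::
  "'a::topological_space measure \<Rightarrow> 'b::topological_space measure \<Rightarrow> ('a \<times> 'b) measure set" where
  "couplings M N =
     {L. prob_space L \<and> sets L = sets borel \<and> distr L M fst = M \<and> distr L N snd = N}"

definition kantorovich_inf ::
  "'a::topological_space measure \<Rightarrow> 'b::topological_space measure \<Rightarrow> ('a \<times> 'b \<Rightarrow> real) \<Rightarrow> real"
  where "kantorovich_inf M N c = (INF L\<in>couplings M N. integral\<^sup>L L c)"

definition infinite_matrices :: "(nat \<times> nat \<Rightarrow> real) measure" where
  "infinite_matrices = PiM ({1..} \<times> {1..}) (\<lambda>_. borel)"

definition symmetric_matrix_distribution ::
  "'a measure \<Rightarrow> ('a \<times> 'a \<Rightarrow> real) \<Rightarrow> (nat \<times> nat \<Rightarrow> real) measure" where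
  "symmetric_matrix_distribution M f =
     distr (PiM {1..} (\<lambda>_::nat. M)) infinite_matrices
       (\<lambda>x. restrict (\<lambda>(i, j). f (x i, x j)) ({1..} \<times> {1..}))"

text \<open>
  Only the entries with indices in \<open>{1..n}\<close> matter; values elsewhere are unconstrained.
\<close>

definition bistochastic :: "nat \<Rightarrow> (nat \<times> nat \<Rightarrow> real) \<Rightarrow> bool" where
  "bistochastic n l \<longleftrightarrow>
     (\<forall>i\<in>{1..n}. \<forall>j\<in>{1..n}. l (i, j) \<ge> 0) \<and>
     (\<forall>j\<in>{1..n}. (\<Sum>i=1..n. l (i, j)) = 1) \<and>
     (\<forall>i\<in>{1..n}. (\<Sum>j=1..n. l (i, j)) = 1)"

definition matrix_kantorovich_inf :: "nat \<Rightarrow> (nat \<times> nat \<Rightarrow> real) \<Rightarrow> real" where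
  "matrix_kantorovich_inf n r =
     (INF l\<in>{l. bistochastic n l}. 1 / real n * (\<Sum>i=1..n. \<Sum>j=1..n. l (i, j) * r (i, j)))"

end

theory Submission
  imports Defs
begin

text \<open>
  Since \<open>r i j = dist (x i) (S (x j))\<close>, the number \<open>k\<^sub>n r\<close> is the optimal transport cost between
  the empirical measures of \<open>x\<close> and of \<open>S \<circ> x\<close>, while \<open>k\<close> is the cost between \<open>\<mu>\<^sub>1\<close> and \<open>\<mu>\<^sub>2\<close>.
  Cut the space into finitely many Borel cells of radius less than \<open>e\<close>. Up to \<open>2 * e\<close>, a coupling of
  \<open>\<mu>\<^sub>1\<close> and \<open>\<mu>\<^sub>2\<close> costs the same as the finite transport plan between the cell masses that it induces,
  and every such plan is induced by a coupling; the same holds for bistochastic matrices and plans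
  between the cell frequencies. Finite plans depend stably on their marginals, and by Hoeffding's
  inequality the cell frequencies converge in probability to the cell masses.
\<close>

section \<open>Borel sets of a compact metric space\<close>

lemma compact_ball_cover:
  assumes "compact (UNIV :: 'a::metric_space set)" "e > 0"
  obtains K :: "'a::metric_space set" where "finite K" "(\<Union>x\<in>K. ball x e) = UNIV"
  using assms unfolding compact_eq_totally_bounded by (metis UNIV_I subset_UNIV subset_antisym)

text \<open>
  The library identifies the product Borel algebra only for types of class
  \<open>second_countable_topology\<close>, which is not available for a compact metric space.
\<close>
lemma measurable_borel_prod:
  assumes "compact (UNIV :: 'a::metric_space set)"
  shows "(\<lambda>x. x) \<in> borel_measurable (borel \<Otimes>\<^sub>M borel :: ('a \<times> 'a) measure)"
proof (rule borel_measurableI)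
  fix U :: "('a \<times> 'a) set" assume U: "open U"
  have "\<exists>K :: 'a set. finite K \<and> (\<Union>x\<in>K. ball x (1 / real (Suc n))) = UNIV" for n
    by (rule compact_ball_cover[OF assms, of "1 / real (Suc n)"]) auto
  then obtain K :: "nat \<Rightarrow> 'a set" where K: "\<And>n. finite (K n)"
    "\<And>n. (\<Union>x\<in>K n. ball x (1 / real (Suc n))) = UNIV"
    by metis
  \<comment> \<open>The balls of radius \<open>1 / real (Suc n)\<close> about the finitely many
    points of \<open>K n\<close>, taken over all \<open>n\<close>, form a countable base; this is
    what compactness contributes.\<close>
  define B where "B = (\<Union>n. (\<lambda>x. ball x (1 / real (Suc n))) ` K n)"
  have cB: "countable B"
    unfolding B_def using K(1) by (intro countable_UN) (auto intro: countable_finite)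
  \<comment> \<open>\<open>C\<close> collects the boxes of base sets inside \<open>U\<close>. They
    cover \<open>U\<close>, which is therefore a countable union of measurable rectangles.\<close>
  define C where "C = {P \<in> B \<times> B. fst P \<times> snd P \<subseteq> U}"
  have "\<exists>P\<in>C. (x, y) \<in> fst P \<times> snd P" if xy: "(x, y) \<in> U" for x y
  proof -
    obtain V W where VW: "open V" "open W" "x \<in> V" "y \<in> W" "V \<times> W \<subseteq> U"
      using U xy by (rule open_prod_elim) auto
    obtain e1 e2 where e: "e1 > 0" "ball x e1 \<subseteq> V" "e2 > 0" "ball y e2 \<subseteq> W"
      using VW by (meson openE)
    \<comment> \<open>Half of the smaller radius is needed because two points of a ball of radius
      \<open>1 / real (Suc n)\<close> may be almost twice that radius apart.\<close>
    obtain n where n: "1 / real (Suc n) < min e1 e2 / 2"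
      using e nat_approx_posE[of "min e1 e2 / 2"] by auto
    obtain a b where ab: "a \<in> K n" "b \<in> K n" "x \<in> ball a (1 / real (Suc n))" "y \<in> ball b (1 / real (Suc n))"
      using K(2)[of n] by blast
    have sub: "ball c (1 / real (Suc n)) \<subseteq> ball z d"
      if "z \<in> ball c (1 / real (Suc n))" "1 / real (Suc n) < d / 2" for c z :: 'a and d
    proof
      fix w assume "w \<in> ball c (1 / real (Suc n))"
      then show "w \<in> ball z d"
        using that dist_triangle[of z w c] by (simp add: dist_commute)
    qed
    have "ball a (1 / real (Suc n)) \<times> ball b (1 / real (Suc n)) \<subseteq> U"
      using sub[OF ab(3), of e1] sub[OF ab(4), of e2] n e VW(5) by (smt (verit) SigmaE mem_Sigma_iff subset_iff min_def field_sum_of_halves)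
    then have "(ball a (1 / real (Suc n)), ball b (1 / real (Suc n))) \<in> C"
      unfolding C_def B_def using ab by auto
    with ab show ?thesis by force
  qed
  then have "U = (\<Union>P\<in>C. fst P \<times> snd P)"
    unfolding C_def by fastforce
  moreover have "countable C"
    using cB unfolding C_def by (auto intro: countable_subset[OF _ countable_SIGMA[OF cB cB]])
  moreover have "fst P \<times> snd P \<in> sets (borel \<Otimes>\<^sub>M borel)" if "P \<in> C" for P
    using that unfolding C_def B_def by (auto intro!: pair_measureI)
  ultimately have "U \<in> sets (borel \<Otimes>\<^sub>M borel)"
    by (metis (no_types, lifting) sets.countable_UN'')
  then show "(\<lambda>x. x) -` U \<inter> space (borel \<Otimes>\<^sub>M borel) \<in> sets (borel \<Otimes>\<^sub>M borel)"
    by (simp add: space_pair_measure)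
qed

lemma measurable_fst_borel: "fst \<in> borel_measurable (borel :: ('a::topological_space \<times> 'b::topological_space) measure)"
  and measurable_snd_borel: "snd \<in> borel_measurable (borel :: ('a::topological_space \<times> 'b::topological_space) measure)"
  by (auto intro!: borel_measurable_continuous_onI continuous_intros)

text \<open>Elements of \<open>couplings\<close> live on the Borel algebra of the product topology,
  whereas Fubini arguments use the product algebra. One inclusion is
  \<open>measurable_borel_prod\<close>, the other is continuity of the projections.\<close>

lemma sets_borel_prod:
  assumes "compact (UNIV :: 'a::metric_space set)"
  shows "sets (borel \<Otimes>\<^sub>M borel) = sets (borel :: ('a \<times> 'a) measure)"
proof
  show "sets (borel :: ('a \<times> 'a) measure) \<subseteq> sets (borel \<Otimes>\<^sub>M borel)"
    using measurable_sets[OF measurable_borel_prod[OF assms]] by (auto simp: space_pair_measure)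
  have "(\<lambda>z. (fst z, snd z)) \<in> (borel :: ('a \<times> 'a) measure) \<rightarrow>\<^sub>M borel \<Otimes>\<^sub>M borel"
    by (intro measurable_Pair measurable_fst_borel measurable_snd_borel)
  from measurable_sets[OF this]
  show "sets (borel \<Otimes>\<^sub>M borel) \<subseteq> sets (borel :: ('a \<times> 'a) measure)"
    by auto
qed

text \<open>Sending a point to the least index of a centre within distance \<open>e\<close> turns
  the overlapping cover into disjoint Borel cells, since the distance to a centre is
  continuous.\<close>

lemma finite_borel_classification:
  assumes "compact (UNIV :: 'a::metric_space set)" "e > 0"
  obtains m :: nat and c :: "'a::metric_space \<Rightarrow> nat" and z :: "nat \<Rightarrow> 'a"
  where "c \<in> borel \<rightarrow>\<^sub>M count_space UNIV" "\<forall>x. c x < m" "\<forall>x. dist x (z (c x)) < e"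
proof -
  obtain K :: "'a set" where K: "finite K" "(\<Union>x\<in>K. ball x e) = UNIV"
    using compact_ball_cover[OF assms] .
  obtain z :: "nat \<Rightarrow> 'a" and m where z: "K = z ` {i::nat. i < m}"
    using finite_imp_nat_seg_image_inj_on[OF K(1)] by blast
  have ex: "\<exists>i<m. dist x (z i) < e" for x
    using K(2) unfolding z by (force simp: dist_commute)
  define c where "c x = (LEAST i. dist x (z i) < e)" for x
  have "c \<in> borel \<rightarrow>\<^sub>M count_space UNIV"
  proof -
    have [measurable]: "(\<lambda>x. dist x (z i)) \<in> borel_measurable borel" for i
      by (intro borel_measurable_continuous_onI continuous_intros)
    show ?thesis unfolding c_def by measurable
  qed
  moreover have "c x < m" for x
    using ex[of x] Least_le[of "\<lambda>i. dist x (z i) < e"] unfolding c_def by (meson le_less_trans)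
  moreover have "dist x (z (c x)) < e" for x
    using ex[of x] LeastI[of "\<lambda>i. dist x (z i) < e"] unfolding c_def by meson
  ultimately show ?thesis using that by metis
qed

section \<open>Law of large numbers for frequencies\<close>

text \<open>The coordinates are i.i.d., so the indicators of \<open>E\<close> are i.i.d. with values
  in \<open>[0, 1]\<close> and mean \<open>measure M E\<close>; Hoeffding's inequality then gives an
  exponential tail bound.\<close>

lemma frequency_tendsto_in_probability:
  assumes "prob_space M" "E \<in> sets M" "\<delta> > 0"
  shows "(\<lambda>n. measure (PiM {1..} (\<lambda>_::nat. M))
            {x \<in> space (PiM {1..} (\<lambda>_. M)). \<bar>(\<Sum>i=1..n. indicator E (x i)) / real n - measure M E\<bar> \<ge> \<delta>})
         \<longlonglongrightarrow> 0"
proof -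
  interpret M: prob_space M by fact
  let ?P = "PiM {1..} (\<lambda>_::nat. M)"
  interpret P: prob_space ?P
    using assms(1) by (intro prob_space_PiM)
  have E [measurable]: "E \<in> sets M" by fact
  have hoeff: "P.prob {x \<in> space ?P. \<bar>(\<Sum>i=1..n. indicator E (x i)) / real n - measure M E\<bar> \<ge> \<delta>}
      \<le> 2 * exp (-2 * real n * \<delta>\<^sup>2)" if n: "n > 0" for n
  proof -
    have comp: "distr ?P M (\<lambda>x. x i) = M" if "i \<in> {1..n}" for i
      using that assms(1) by (intro distr_PiM_component) auto
    \<comment> \<open>Independence is verified through the joint law of the first \<open>n\<close>
      coordinates, which is again a product.\<close>
    have "distr ?P (PiM {1..n} (\<lambda>_. M)) (\<lambda>x. \<lambda>i\<in>{1..n}. x i) = PiM {1..n} (\<lambda>_. M)"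
      using distr_PiM_reindex[of "{1..}" "\<lambda>_. M" "\<lambda>i. i" "{1..n}"] assms(1) by auto
    then have "P.indep_vars (\<lambda>_. M) (\<lambda>i x. x i) {1..n}"
      using n comp by (subst P.indep_vars_iff_distr_eq_PiM') (auto intro!: PiM_cong)
    then have ind: "P.indep_vars (\<lambda>_. borel) (\<lambda>i x. indicator E (x i) :: real) {1..n}"
      by (rule P.indep_vars_compose2) auto
    have same: "distr ?P borel (\<lambda>x. indicator E (x i) :: real) = distr M borel (indicator E)"
      if "i \<in> {1..n}" for i
      using that by (subst comp[OF that, symmetric], subst distr_distr) (auto simp: o_def)
    \<comment> \<open>Coordinate 1 represents the common law; it lies in the index range because
      \<open>n > 0\<close>.\<close>
    interpret H: Hoeffding_ineq_iid ?P "{1..n}" "\<lambda>i x. indicator E (x i)" "\<lambda>x. indicator E (x 1)" 0 1 "measure M E"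
    proof unfold_locales
      have "P.expectation (\<lambda>x. indicator E (x 1)) = (\<integral>y. y \<partial>distr ?P borel (\<lambda>x. indicator E (x 1) :: real))"
        by (subst integral_distr) auto
      also have "\<dots> = measure M E"
        using n by (subst same) (auto simp: integral_distr)
      finally show "measure M E \<equiv> P.expectation (\<lambda>x. indicator E (x 1))" by simp
    qed (use n ind same in \<open>auto simp: indicator_def\<close>)
    show ?thesis
      using H.Hoeffding_ineq_abs_ge'[of \<delta>] n assms(3) by simp
  qed
  \<comment> \<open>For fixed \<open>\<delta>\<close> the bound is a geometric sequence with ratio
    below 1.\<close>
  have "(\<lambda>n. 2 * exp (-2 * \<delta>\<^sup>2) ^ n) \<longlonglongrightarrow> 2 * 0"
    using assms(3) by (intro tendsto_mult tendsto_const LIMSEQ_power_zero) simp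
  moreover have "exp (-2 * \<delta>\<^sup>2) ^ n = exp (-2 * real n * \<delta>\<^sup>2)" for n
    by (simp add: exp_of_nat_mult[symmetric] mult_ac)
  ultimately have "(\<lambda>n. 2 * exp (-2 * real n * \<delta>\<^sup>2)) \<longlonglongrightarrow> 0"
    by simp
  then show ?thesis
  proof (rule Lim_null_comparison[rotated])
    show "\<forall>\<^sub>F n in sequentially. norm (P.prob {x \<in> space ?P. \<bar>(\<Sum>i=1..n. indicator E (x i)) / real n - measure M E\<bar> \<ge> \<delta>})
      \<le> 2 * exp (-2 * real n * \<delta>\<^sup>2)"
      using hoeff by (intro eventually_mono[OF eventually_gt_at_top[of 0]]) auto
  qed
qed

section \<open>Finite transport plans\<close>

definition transport_plan ::
  "'i set \<Rightarrow> 'j set \<Rightarrow> ('i \<Rightarrow> real) \<Rightarrow> ('j \<Rightarrow> real) \<Rightarrow> ('i \<Rightarrow> 'j \<Rightarrow> real) \<Rightarrow> bool" where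
  "transport_plan I J p q \<pi> \<longleftrightarrow>
     (\<forall>i\<in>I. \<forall>j\<in>J. \<pi> i j \<ge> 0) \<and>
     (\<forall>i\<in>I. (\<Sum>j\<in>J. \<pi> i j) = p i) \<and>
     (\<forall>j\<in>J. (\<Sum>i\<in>I. \<pi> i j) = q j)"

definition plan_cost :: "'i set \<Rightarrow> 'j set \<Rightarrow> ('i \<Rightarrow> 'j \<Rightarrow> real) \<Rightarrow> ('i \<Rightarrow> 'j \<Rightarrow> real) \<Rightarrow> real" where
  "plan_cost I J d \<pi> = (\<Sum>i\<in>I. \<Sum>j\<in>J. \<pi> i j * d i j)"

lemma transport_planD:
  assumes "transport_plan I J p q \<pi>"
  shows "\<And>i j. i \<in> I \<Longrightarrow> j \<in> J \<Longrightarrow> \<pi> i j \<ge> 0"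
    and "\<And>i. i \<in> I \<Longrightarrow> (\<Sum>j\<in>J. \<pi> i j) = p i"
    and "\<And>j. j \<in> J \<Longrightarrow> (\<Sum>i\<in>I. \<pi> i j) = q j"
  using assms unfolding transport_plan_def by auto

text \<open>A nonnegative entry cannot exceed its row or column sum. In particular it vanishes
  wherever one of the marginals does.\<close>

lemma transport_plan_le:
  assumes "transport_plan I J p q \<pi>" "finite I" "finite J" "i \<in> I" "j \<in> J"
  shows "\<pi> i j \<le> p i" "\<pi> i j \<le> q j"
  using member_le_sum[of j J "\<pi> i"] member_le_sum[of i I "\<lambda>i. \<pi> i j"] transport_planD[OF assms(1)] assms(2-5)
  by auto

lemma transport_plan_total:
  assumes "transport_plan I J p q \<pi>"
  shows "(\<Sum>i\<in>I. \<Sum>j\<in>J. \<pi> i j) = sum p I"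
  using assms unfolding transport_plan_def by simp

text \<open>Cutting down the rows and columns that carry too much mass removes at most
  \<open>\<delta>\<close> per row and per column. Dropping mass never raises the cost because
  \<open>d\<close> is nonnegative, and the mass put back costs at most \<open>D\<close> per
  unit.\<close>

lemma transport_plan_change_marginals:
  fixes p p' :: "'i \<Rightarrow> real" and q q' :: "'j \<Rightarrow> real"
  assumes fin: "finite I" "finite J" and plan: "transport_plan I J p q \<pi>"
    and p': "\<And>i. i \<in> I \<Longrightarrow> p' i \<ge> 0" "sum p' I = 1" "\<And>i. i \<in> I \<Longrightarrow> \<bar>p i - p' i\<bar> \<le> \<delta>"
    and q': "\<And>j. j \<in> J \<Longrightarrow> q' j \<ge> 0" "sum q' J = 1" "\<And>j. j \<in> J \<Longrightarrow> \<bar>q j - q' j\<bar> \<le> \<delta>"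
    and p: "sum p I = 1"
    and d: "\<And>i j. i \<in> I \<Longrightarrow> j \<in> J \<Longrightarrow> 0 \<le> d i j \<and> d i j \<le> D"
  obtains \<pi>' where "transport_plan I J p' q' \<pi>'"
    "plan_cost I J d \<pi>' \<le> plan_cost I J d \<pi> + D * (real (card I + card J) * \<delta>)"
proof -
  note \<pi> = transport_planD[OF plan]
  have p0: "p i \<ge> 0" if "i \<in> I" for i
    using \<pi>(1,2) that by (metis sum_nonneg)
  have q0: "q j \<ge> 0" if "j \<in> J" for j
    using \<pi>(1,3) that by (metis sum_nonneg)
  \<comment> \<open>Marginals of mass 1 rule out empty index sets, so some entry of \<open>d\<close>
    lies between 0 and \<open>D\<close>.\<close>
  have D0: "D \<ge> 0"
  proof -
    obtain i j where "i \<in> I" "j \<in> J"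
      using p'(2) q'(2) by (metis ex_in_conv sum.empty zero_neq_one)
    then show ?thesis using d[of i j] by linarith
  qed
  \<comment> \<open>Shrink the plan until its marginals lie below \<open>p'\<close> and \<open>q'\<close>, then add a product plan of mass \<open>t\<close>.\<close>
  define \<alpha> where "\<alpha> i = (if p i \<le> p' i then 1 else p' i / p i)" for i
  define \<beta> where "\<beta> j = (if q j \<le> q' j then 1 else q' j / q j)" for j
  have \<alpha>: "0 \<le> \<alpha> i" "\<alpha> i \<le> 1" "\<alpha> i * p i \<le> p' i" "p i * (1 - \<alpha> i) \<le> \<delta>" if "i \<in> I" for i
    using p0[OF that] p'(1,3)[OF that] by (auto simp: \<alpha>_def field_simps)
  have \<beta>: "0 \<le> \<beta> j" "\<beta> j \<le> 1" "\<beta> j * q j \<le> q' j" "q j * (1 - \<beta> j) \<le> \<delta>" if "j \<in> J" for j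
    using q0[OF that] q'(1,3)[OF that] by (auto simp: \<beta>_def field_simps)
  define \<pi>0 where "\<pi>0 i j = \<pi> i j * \<alpha> i * \<beta> j" for i j
  have \<pi>0: "0 \<le> \<pi>0 i j" "\<pi>0 i j \<le> \<pi> i j" "\<pi>0 i j \<le> \<alpha> i * \<pi> i j" "\<pi>0 i j \<le> \<beta> j * \<pi> i j"
      "\<pi> i j - \<pi>0 i j \<le> \<pi> i j * (1 - \<alpha> i) + \<pi> i j * (1 - \<beta> j)"
    if ij: "i \<in> I" "j \<in> J" for i j
  proof -
    note [simp] = \<pi>(1)[OF ij] \<alpha>(1,2)[OF ij(1)] \<beta>(1,2)[OF ij(2)]
    show "0 \<le> \<pi>0 i j" by (simp add: \<pi>0_def)
    show a: "\<pi>0 i j \<le> \<alpha> i * \<pi> i j"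
      using mult_left_le[of "\<beta> j" "\<pi> i j * \<alpha> i"] by (simp add: \<pi>0_def mult_ac)
    show "\<pi>0 i j \<le> \<beta> j * \<pi> i j"
      using mult_left_le[of "\<alpha> i" "\<pi> i j * \<beta> j"] by (simp add: \<pi>0_def mult_ac)
    show "\<pi>0 i j \<le> \<pi> i j"
      using a mult_left_le[of "\<alpha> i" "\<pi> i j"] by (simp add: mult_ac)
    \<comment> \<open>Rearranged, this says that the lost fraction
      \<open>1 - \<alpha> i * \<beta> j\<close> is at most the sum of the row loss and the column
      loss.\<close>
    have "0 \<le> \<pi> i j * ((1 - \<alpha> i) * (1 - \<beta> j))" by simp
    then show "\<pi> i j - \<pi>0 i j \<le> \<pi> i j * (1 - \<alpha> i) + \<pi> i j * (1 - \<beta> j)"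
      by (simp add: \<pi>0_def algebra_simps)
  qed
  \<comment> \<open>\<open>u\<close> and \<open>v\<close> are the row and column deficits against
    the new marginals; each adds up to the missing mass \<open>t\<close>.\<close>
  define u where "u i = p' i - (\<Sum>j\<in>J. \<pi>0 i j)" for i
  define v where "v j = q' j - (\<Sum>i\<in>I. \<pi>0 i j)" for j
  define t where "t = 1 - (\<Sum>i\<in>I. \<Sum>j\<in>J. \<pi>0 i j)"
  have u0: "u i \<ge> 0" if "i \<in> I" for i
  proof -
    have "(\<Sum>j\<in>J. \<pi>0 i j) \<le> (\<Sum>j\<in>J. \<alpha> i * \<pi> i j)"
      using that by (intro sum_mono \<pi>0)
    also have "\<dots> = \<alpha> i * p i"
      using \<pi>(2)[OF that] by (simp add: sum_distrib_left[symmetric])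
    finally show ?thesis using \<alpha>(3)[OF that] by (simp add: u_def)
  qed
  have v0: "v j \<ge> 0" if "j \<in> J" for j
  proof -
    have "(\<Sum>i\<in>I. \<pi>0 i j) \<le> (\<Sum>i\<in>I. \<beta> j * \<pi> i j)"
      using that by (intro sum_mono \<pi>0)
    also have "\<dots> = \<beta> j * q j"
      using \<pi>(3)[OF that] by (simp add: sum_distrib_left[symmetric])
    finally show ?thesis using \<beta>(3)[OF that] by (simp add: v_def)
  qed
  have su: "sum u I = t"
    by (simp add: u_def t_def sum_subtractf p')
  have sv: "sum v J = t"
    using sum.swap[of \<pi>0 J I] by (simp add: v_def t_def sum_subtractf q')
  have t0: "t \<ge> 0"
    using su u0 by (metis sum_nonneg)
  have total: "(\<Sum>i\<in>I. \<Sum>j\<in>J. \<pi> i j) = 1"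
    using transport_plan_total[OF plan] p by simp
  have "t = (\<Sum>i\<in>I. \<Sum>j\<in>J. \<pi> i j - \<pi>0 i j)"
    by (simp add: t_def sum_subtractf total)
  also have "\<dots> \<le> (\<Sum>i\<in>I. \<Sum>j\<in>J. \<pi> i j * (1 - \<alpha> i) + \<pi> i j * (1 - \<beta> j))"
    by (intro sum_mono \<pi>0)
  also have "\<dots> = (\<Sum>i\<in>I. \<Sum>j\<in>J. \<pi> i j * (1 - \<alpha> i)) + (\<Sum>j\<in>J. \<Sum>i\<in>I. \<pi> i j * (1 - \<beta> j))"
    by (simp add: sum.distrib sum.swap[of _ J I])
  also have "\<dots> = (\<Sum>i\<in>I. p i * (1 - \<alpha> i)) + (\<Sum>j\<in>J. q j * (1 - \<beta> j))"
    using \<pi>(2,3) by (simp add: sum_distrib_right[symmetric])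
  also have "\<dots> \<le> (\<Sum>i\<in>I. \<delta>) + (\<Sum>j\<in>J. \<delta>)"
    using \<alpha> \<beta> by (intro add_mono sum_mono) auto
  also have "\<dots> = real (card I + card J) * \<delta>"
    by (simp add: algebra_simps)
  finally have t_le: "t \<le> real (card I + card J) * \<delta>" .
  \<comment> \<open>The added plan has marginals \<open>u\<close> and \<open>v\<close>. If
    \<open>t = 0\<close>, all deficits vanish and division by zero yields 0, so the formula stays
    correct.\<close>
  define \<pi>' where "\<pi>' i j = \<pi>0 i j + u i * v j / t" for i j
  have row: "(\<Sum>j\<in>J. u i * v j / t) = u i" if "i \<in> I" for i
  proof (cases "t = 0")
    case True
    then have "u i = 0"
      using su u0 that fin by (metis sum_nonneg_eq_0_iff)
    then show ?thesis by simp
  qed (simp add: sv sum_distrib_left[symmetric] sum_divide_distrib[symmetric])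
  have col: "(\<Sum>i\<in>I. u i * v j / t) = v j" if "j \<in> J" for j
  proof (cases "t = 0")
    case True
    then have "v j = 0"
      using sv v0 that fin by (metis sum_nonneg_eq_0_iff)
    then show ?thesis by simp
  qed (simp add: su sum_distrib_right[symmetric] sum_divide_distrib[symmetric])
  have "transport_plan I J p' q' \<pi>'"
    unfolding transport_plan_def
  proof (intro conjI ballI)
    show "0 \<le> \<pi>' i j" if "i \<in> I" "j \<in> J" for i j
      using \<pi>0(1)[OF that] u0 v0 t0 that by (simp add: \<pi>'_def)
    show "(\<Sum>j\<in>J. \<pi>' i j) = p' i" if "i \<in> I" for i
      using row[OF that] by (simp add: \<pi>'_def sum.distrib u_def)
    show "(\<Sum>i\<in>I. \<pi>' i j) = q' j" if "j \<in> J" for j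
      using col[OF that] by (simp add: \<pi>'_def sum.distrib v_def)
  qed
  moreover
  have "plan_cost I J d \<pi>' \<le> (\<Sum>i\<in>I. \<Sum>j\<in>J. \<pi> i j * d i j + D * (u i * v j / t))"
    unfolding plan_cost_def
  proof (intro sum_mono)
    fix i j assume ij: "i \<in> I" "j \<in> J"
    have "\<pi>0 i j * d i j \<le> \<pi> i j * d i j"
      using \<pi>0(2)[OF ij] d[OF ij] by (intro mult_right_mono) auto
    moreover have "(u i * v j / t) * d i j \<le> (u i * v j / t) * D"
      using u0[OF ij(1)] v0[OF ij(2)] t0 d[OF ij] by (intro mult_left_mono) auto
    ultimately show "\<pi>' i j * d i j \<le> \<pi> i j * d i j + D * (u i * v j / t)"
      unfolding \<pi>'_def by (simp add: algebra_simps)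
  qed
  then have "plan_cost I J d \<pi>' \<le> plan_cost I J d \<pi> + D * (\<Sum>i\<in>I. \<Sum>j\<in>J. u i * v j / t)"
    by (simp only: plan_cost_def sum.distrib sum_distrib_left)
  then have "plan_cost I J d \<pi>' \<le> plan_cost I J d \<pi> + D * t"
    using row su by simp
  with mult_left_mono[OF t_le D0] have "plan_cost I J d \<pi>' \<le> plan_cost I J d \<pi> + D * (real (card I + card J) * \<delta>)"
    by linarith
  ultimately show ?thesis using that by blast
qed

text \<open>
  The density takes the value 1 on cells of mass 0, so that its row and column averages are 1
  without exception; this spares null-set arguments when a coupling is built from it.
\<close>
lemma transport_plan_relative_density:
  assumes fin: "finite I" "finite J" and plan: "transport_plan I J p q \<pi>"
    and one: "sum p I = 1" "sum q J = 1"
  obtains w where "\<And>i j. i \<in> I \<Longrightarrow> j \<in> J \<Longrightarrow> w i j \<ge> 0"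
    "\<And>i j. i \<in> I \<Longrightarrow> j \<in> J \<Longrightarrow> p i * q j * w i j = \<pi> i j"
    "\<And>i. i \<in> I \<Longrightarrow> (\<Sum>j\<in>J. q j * w i j) = 1"
    "\<And>j. j \<in> J \<Longrightarrow> (\<Sum>i\<in>I. p i * w i j) = 1"
proof
  note \<pi> = transport_planD[OF plan] and le = transport_plan_le[OF plan fin]
  have p0: "p i \<ge> 0" if "i \<in> I" for i
    using \<pi>(1,2) that by (metis sum_nonneg)
  have q0: "q j \<ge> 0" if "j \<in> J" for j
    using \<pi>(1,3) that by (metis sum_nonneg)
  define w where "w i j = (if p i = 0 \<or> q j = 0 then 1 else \<pi> i j / (p i * q j))" for i j
  fix i j
  show "w i j \<ge> 0" if "i \<in> I" "j \<in> J"
    using p0 q0 \<pi>(1) that by (simp add: w_def)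
  \<comment> \<open>Where a marginal vanishes, \<open>transport_plan_le\<close> forces
    \<open>\<pi> i j = 0\<close>, so the default value 1 is consistent with this identity.\<close>
  show "p i * q j * w i j = \<pi> i j" if "i \<in> I" "j \<in> J"
    using le[OF that] \<pi>(1)[OF that] by (auto simp: w_def)
  show "(\<Sum>j\<in>J. q j * w i j) = 1" if i: "i \<in> I"
  proof (cases "p i = 0")
    case True
    then show ?thesis by (simp add: w_def one)
  next
    case False
    have "(\<Sum>j\<in>J. q j * w i j) = (\<Sum>j\<in>J. \<pi> i j / p i)"
      using le(2)[OF i] \<pi>(1)[OF i] False by (intro sum.cong) (force simp: w_def)+
    then show ?thesis
      using \<pi>(2)[OF i] False by (simp add: sum_divide_distrib[symmetric])
  qed
  show "(\<Sum>i\<in>I. p i * w i j) = 1" if j: "j \<in> J"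
  proof (cases "q j = 0")
    case True
    then show ?thesis by (simp add: w_def one)
  next
    case False
    have "(\<Sum>i\<in>I. p i * w i j) = (\<Sum>i\<in>I. \<pi> i j / q j)"
      using le(1)[OF _ j] \<pi>(1)[OF _ j] False by (intro sum.cong) (force simp: w_def)+
    then show ?thesis
      using \<pi>(3)[OF j] False by (simp add: sum_divide_distrib[symmetric])
  qed
qed

section \<open>Couplings and finite transport plans\<close>

lemma (in finite_measure)
  fixes g :: "'k \<Rightarrow> real"
  assumes Z: "Z \<in> M \<rightarrow>\<^sub>M count_space UNIV" and K: "finite K" "\<And>x. x \<in> space M \<Longrightarrow> Z x \<in> K"
  shows integrable_finite_range: "integrable M (\<lambda>x. g (Z x))"
    and integral_finite_range:
      "(\<integral>x. g (Z x) \<partial>M) = (\<Sum>k\<in>K. measure M {x \<in> space M. Z x = k} * g k)"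
proof -
  have [measurable]: "{x \<in> space M. Z x = k} \<in> sets M" for k
    using measurable_sets[OF Z, of "{k}"] by (simp add: vimage_def Int_def conj_commute)
  have eq: "g (Z x) = (\<Sum>k\<in>K. indicator {x \<in> space M. Z x = k} x * g k)" if "x \<in> space M" for x
  proof -
    have "(\<Sum>k\<in>K. indicator {x \<in> space M. Z x = k} x * g k) = (\<Sum>k\<in>K. if k = Z x then g k else 0)"
      using that by (intro sum.cong) (auto simp: indicator_def)
    then show ?thesis using K that by simp
  qed
  have int: "integrable M (\<lambda>x. indicator {x \<in> space M. Z x = k} x * g k)" for k
    by (intro integrable_mult_left) (auto simp: emeasure_finite less_top[symmetric])
  show "integrable M (\<lambda>x. g (Z x))"
    using int by (subst Bochner_Integration.integrable_cong[OF refl eq]) auto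
  show "(\<integral>x. g (Z x) \<partial>M) = (\<Sum>k\<in>K. measure M {x \<in> space M. Z x = k} * g k)"
    using int by (subst Bochner_Integration.integral_cong[OF refl eq]) (auto intro!: sum.cong)
qed

lemma (in prob_space) sum_prob_finite_range:
  assumes Z: "Z \<in> M \<rightarrow>\<^sub>M count_space UNIV" and K: "finite K" "\<And>x. x \<in> space M \<Longrightarrow> Z x \<in> K"
  shows "(\<Sum>k\<in>K. measure M {x \<in> space M. Z x = k}) = 1"
  using integral_finite_range[OF assms, of "\<lambda>_. 1"] by (simp add: prob_space)

lemma nn_integral_finite_range:
  assumes "prob_space M" and Z: "Z \<in> M \<rightarrow>\<^sub>M count_space UNIV" and K: "finite K" "\<And>x. x \<in> space M \<Longrightarrow> Z x \<in> K"
    and g: "\<And>k. k \<in> K \<Longrightarrow> g k \<ge> 0"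
  shows "(\<integral>\<^sup>+x. ennreal (g (Z x)) \<partial>M) = ennreal (\<Sum>k\<in>K. measure M {x \<in> space M. Z x = k} * g k)"
proof -
  interpret prob_space M by fact
  show ?thesis
    using integral_finite_range[OF Z K, of g] integrable_finite_range[OF Z K, of g] g K(2)
    by (subst nn_integral_eq_integral) (auto intro!: AE_I2)
qed

text \<open>On each product of two cells the coupling is the product measure times the constant
  relative density \<open>w a b\<close>. The weighted row and column averages of \<open>w\<close>
  are 1, which makes the marginals exactly \<open>M\<close> and \<open>N\<close>.\<close>

lemma coupling_of_transport_plan:
  fixes M N :: "'a::metric_space measure" and c :: "'a \<Rightarrow> nat"
  assumes compact: "compact (UNIV :: 'a set)"
    and M: "prob_space M" "sets M = sets borel" and N: "prob_space N" "sets N = sets borel"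
    and c: "c \<in> borel \<rightarrow>\<^sub>M count_space UNIV" "\<And>x. c x < m"
    and plan: "transport_plan {..<m} {..<m}
      (\<lambda>a. measure M {x. c x = a}) (\<lambda>b. measure N {x. c x = b}) \<pi>"
  shows "\<exists>L\<in>couplings M N. \<forall>a<m. \<forall>b<m. measure L {z. c (fst z) = a \<and> c (snd z) = b} = \<pi> a b"
proof -
  interpret M: prob_space M by fact
  interpret N: prob_space N by fact
  interpret MN: pair_prob_space M N ..
  note [measurable_cong] = M(2) N(2)
  note [measurable] = c(1)
  have sp [simp]: "space M = UNIV" "space N = UNIV"
    using sets_eq_imp_space_eq[OF M(2)] sets_eq_imp_space_eq[OF N(2)] by auto
  let ?p = "\<lambda>a. measure M {x. c x = a}" and ?q = "\<lambda>b. measure N {x. c x = b}"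
  have cM: "c \<in> M \<rightarrow>\<^sub>M count_space UNIV" and cN: "c \<in> N \<rightarrow>\<^sub>M count_space UNIV"
    by measurable
  have one: "sum ?p {..<m} = 1" "sum ?q {..<m} = 1"
    using M.sum_prob_finite_range[OF cM, of "{..<m}"] N.sum_prob_finite_range[OF cN, of "{..<m}"] c(2) by auto
  obtain w where w: "\<And>a b. a < m \<Longrightarrow> b < m \<Longrightarrow> w a b \<ge> 0"
    "\<And>a b. a < m \<Longrightarrow> b < m \<Longrightarrow> ?p a * ?q b * w a b = \<pi> a b"
    "\<And>a. a < m \<Longrightarrow> (\<Sum>b<m. ?q b * w a b) = 1"
    "\<And>b. b < m \<Longrightarrow> (\<Sum>a<m. ?p a * w a b) = 1"
    using transport_plan_relative_density[OF finite_lessThan finite_lessThan plan one] unfolding lessThan_iff by blast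
  define h where "h z = ennreal (w (c (fst z)) (c (snd z)))" for z
  have h [measurable]: "h \<in> borel_measurable (M \<Otimes>\<^sub>M N)"
    unfolding h_def by measurable
  define L where "L = density (M \<Otimes>\<^sub>M N) h"
  have setsL: "sets L = sets (M \<Otimes>\<^sub>M N)"
    by (simp add: L_def)
  \<comment> \<open>Both inner integrals equal 1 at every point, also on cells of measure 0, so the
    marginals follow from Tonelli's theorem without exceptional sets.\<close>
  have inner1: "(\<integral>\<^sup>+y. h (x, y) \<partial>N) = 1" for x
    using nn_integral_finite_range[OF N(1) cN, of "{..<m}" "w (c x)"] w(1,3) c(2) by (simp add: h_def)
  have inner2: "(\<integral>\<^sup>+x. h (x, y) \<partial>M) = 1" for y
    using nn_integral_finite_range[OF M(1) cM, of "{..<m}" "\<lambda>a. w a (c y)"] w(1,4) c(2) by (simp add: h_def)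
  have fst: "distr L M fst = M"
  proof (rule measure_eqI)
    fix A assume "A \<in> sets (distr L M fst)"
    then have A [measurable]: "A \<in> sets M" by simp
    have [measurable]: "fst -` A \<in> sets (M \<Otimes>\<^sub>M N)"
      using measurable_sets[OF measurable_fst A, of N] by (simp add: space_pair_measure)
    have "emeasure (distr L M fst) A = emeasure L (fst -` A \<inter> space L)"
      by (subst emeasure_distr) (auto simp: L_def)
    also have "\<dots> = (\<integral>\<^sup>+z. h z * indicator A (fst z) \<partial>(M \<Otimes>\<^sub>M N))"
      unfolding L_def by (subst emeasure_density) (auto intro!: nn_integral_cong simp: indicator_def space_pair_measure)
    also have "\<dots> = (\<integral>\<^sup>+x. \<integral>\<^sup>+y. h (x, y) * indicator A x \<partial>N \<partial>M)"
      by (subst N.nn_integral_fst[symmetric]) auto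
    also have "\<dots> = emeasure M A"
      by (subst nn_integral_multc) (auto simp: inner1)
    finally show "emeasure (distr L M fst) A = emeasure M A" .
  qed simp
  have snd: "distr L N snd = N"
  proof (rule measure_eqI)
    fix A assume "A \<in> sets (distr L N snd)"
    then have A [measurable]: "A \<in> sets N" by simp
    have [measurable]: "snd -` A \<in> sets (M \<Otimes>\<^sub>M N)"
      using measurable_sets[OF measurable_snd A, of M] by (simp add: space_pair_measure)
    have "emeasure (distr L N snd) A = emeasure L (snd -` A \<inter> space L)"
      by (subst emeasure_distr) (auto simp: L_def)
    also have "\<dots> = (\<integral>\<^sup>+z. h z * indicator A (snd z) \<partial>(M \<Otimes>\<^sub>M N))"
      unfolding L_def by (subst emeasure_density) (auto intro!: nn_integral_cong simp: indicator_def space_pair_measure)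
    also have "\<dots> = (\<integral>\<^sup>+y. \<integral>\<^sup>+x. h (x, y) * indicator A y \<partial>M \<partial>N)"
      by (subst MN.nn_integral_snd[symmetric]) auto
    also have "\<dots> = emeasure N A"
      by (subst nn_integral_multc) (auto simp: inner2)
    finally show "emeasure (distr L N snd) A = emeasure N A" .
  qed simp
  have "prob_space L"
    by (rule prob_space_distrD[of fst L M]) (simp_all add: fst M(1), simp add: L_def)
  moreover have "sets L = sets borel"
    using sets_borel_prod[OF compact] sets_pair_measure_cong[OF M(2) N(2)] by (simp add: setsL)
  ultimately have "L \<in> couplings M N"
    unfolding couplings_def using fst snd by auto
  moreover have "measure L {z. c (fst z) = a \<and> c (snd z) = b} = \<pi> a b" if ab: "a < m" "b < m" for a b
  proof -
    have set: "{z. c (fst z) = a \<and> c (snd z) = b} = {x. c x = a} \<times> {y. c y = b}" by auto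
    have [measurable]: "{x. c x = a} \<in> sets M" "{y. c y = b} \<in> sets N"
      using measurable_sets[OF cM, of "{a}"] measurable_sets[OF cN, of "{b}"] by (auto simp: vimage_def)
    have "emeasure L {z. c (fst z) = a \<and> c (snd z) = b}
        = (\<integral>\<^sup>+z. ennreal (w a b) * indicator ({x. c x = a} \<times> {y. c y = b}) z \<partial>(M \<Otimes>\<^sub>M N))"
      unfolding L_def set by (subst emeasure_density) (auto intro!: nn_integral_cong simp: indicator_def h_def)
    also have "\<dots> = ennreal (w a b) * (emeasure M {x. c x = a} * emeasure N {y. c y = b})"
      by (subst nn_integral_cmult_indicator) (auto simp: N.emeasure_pair_measure_Times)
    also have "\<dots> = ennreal (\<pi> a b)"
      using w(1)[OF ab]
      by (simp add: w(2)[OF ab, symmetric] M.emeasure_eq_measure N.emeasure_eq_measure ennreal_mult[symmetric] mult_ac)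
    finally show ?thesis
      using transport_planD(1)[OF plan] ab by (simp add: measure_def)
  qed
  ultimately show ?thesis by blast
qed

lemma couplingsD:
  assumes "L \<in> couplings M N"
  shows "prob_space L" "sets L = sets borel" "space L = UNIV" "distr L M fst = M" "distr L N snd = N"
  using assms sets_eq_imp_space_eq[of L borel] unfolding couplings_def by auto

text \<open>The plan is the law of the pair of cell indices under \<open>L\<close>; its marginals
  are found by splitting the event for one coordinate according to the cell of the other.\<close>

lemma transport_plan_of_coupling:
  fixes M N :: "'a::metric_space measure" and c :: "'a \<Rightarrow> nat"
  assumes M: "sets M = sets borel" and N: "sets N = sets borel"
    and c: "c \<in> borel \<rightarrow>\<^sub>M count_space UNIV" "\<And>x. c x < m"
    and L: "L \<in> couplings M N"
  shows "transport_plan {..<m} {..<m} (\<lambda>a. measure M {x. c x = a}) (\<lambda>b. measure N {x. c x = b})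
    (\<lambda>a b. measure L {z. c (fst z) = a \<and> c (snd z) = b})"
proof -
  note L = couplingsD[OF L]
  interpret L: prob_space L by fact
  note [measurable_cong] = M N L(2)
  note [measurable] = c(1) measurable_fst_borel measurable_snd_borel
  have sp [simp]: "space M = UNIV" "space N = UNIV"
    using sets_eq_imp_space_eq[OF M] sets_eq_imp_space_eq[OF N] by auto
  have [measurable]: "{x. c x = a} \<in> sets borel" for a
    using measurable_sets[OF c(1), of "{a}"] by (auto simp: vimage_def)
  have ev: "{z. c (fst z) = a \<and> c (snd z) = b} \<in> sets L" for a b
  proof -
    have "{z \<in> space L. c (fst z) = a \<and> c (snd z) = b} \<in> sets L" by measurable
    then show ?thesis by (simp add: L)
  qed
  have fst_meas: "fst \<in> L \<rightarrow>\<^sub>M M" and snd_meas: "snd \<in> L \<rightarrow>\<^sub>M N"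
    using measurable_fst_borel measurable_snd_borel
    by (simp_all add: measurable_cong_sets[OF L(2) M] measurable_cong_sets[OF L(2) N])
  have M1: "measure M {x. c x = a} = measure L {z. c (fst z) = a}" for a
    using measure_distr[OF fst_meas, of "{x. c x = a}"] M L by (simp add: vimage_def)
  have N1: "measure N {x. c x = a} = measure L {z. c (snd z) = a}" for a
    using measure_distr[OF snd_meas, of "{x. c x = a}"] N L by (simp add: vimage_def)
  show ?thesis
    unfolding transport_plan_def
  proof (intro conjI ballI)
    fix a
    have "{z. c (fst z) = a} = (\<Union>b<m. {z. c (fst z) = a \<and> c (snd z) = b})"
      using c(2) by auto
    then show "(\<Sum>b<m. measure L {z. c (fst z) = a \<and> c (snd z) = b}) = measure M {x. c x = a}"
      unfolding M1 using ev
      by (subst L.finite_measure_finite_Union[symmetric]) (auto simp: disjoint_family_on_def)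
    have "{z. c (snd z) = a} = (\<Union>b<m. {z. c (fst z) = b \<and> c (snd z) = a})"
      using c(2) by auto
    then show "(\<Sum>b<m. measure L {z. c (fst z) = b \<and> c (snd z) = a}) = measure N {x. c x = a}"
      unfolding N1 using ev
      by (subst L.finite_measure_finite_Union[symmetric]) (auto simp: disjoint_family_on_def)
  qed auto
qed

text \<open>Replacing both points by the centres of their cells changes their distance by less than
  \<open>2 * e\<close>, and the expected distance of the centres depends only on the masses of the
  cell pairs.\<close>

lemma coupling_cost_approx:
  fixes L :: "('a::metric_space \<times> 'a) measure" and c :: "'a \<Rightarrow> nat"
  assumes compact: "compact (UNIV :: 'a set)"
    and L: "prob_space L" "sets L = sets borel"
    and c: "c \<in> borel \<rightarrow>\<^sub>M count_space UNIV" "\<And>x. c x < m" "\<And>x. dist x (z (c x)) < e"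
  shows "\<bar>(\<integral>(x, y). dist x y \<partial>L) - plan_cost {..<m} {..<m} (\<lambda>a b. dist (z a) (z b))
    (\<lambda>a b. measure L {z. c (fst z) = a \<and> c (snd z) = b})\<bar> \<le> 2 * e"
proof -
  interpret L: prob_space L by fact
  note [measurable_cong] = L(2)
  note [measurable] = c(1) measurable_fst_borel measurable_snd_borel
  have sp [simp]: "space L = UNIV"
    using sets_eq_imp_space_eq[OF L(2)] by auto
  have dist_measurable: "(\<lambda>z :: 'a \<times> 'a. dist (fst z) (snd z)) \<in> borel_measurable L"
    by (subst measurable_cong_sets[OF L(2) refl], intro borel_measurable_continuous_onI continuous_intros)
  \<comment> \<open>Compactness bounds the metric, which makes the distance integrable under
    \<open>L\<close>.\<close>
  obtain D where D: "\<And>x y :: 'a. dist x y \<le> D"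
    using compact_imp_bounded[OF compact] unfolding bounded_two_points by auto
  have int: "integrable L (\<lambda>z. dist (fst z) (snd z))"
    using D by (intro L.integrable_const_bound[of _ D] dist_measurable) auto
  define Z where "Z w = (c (fst w), c (snd w))" for w :: "'a \<times> 'a"
  have Z: "Z \<in> L \<rightarrow>\<^sub>M count_space UNIV"
    unfolding Z_def by measurable
  define g where "g = (\<lambda>(a, b). dist (z a) (z b))"
  have K: "finite ({..<m} \<times> {..<m})" "\<And>w. w \<in> space L \<Longrightarrow> Z w \<in> {..<m} \<times> {..<m}"
    using c(2) by (auto simp: Z_def)
  have "(\<integral>w. g (Z w) \<partial>L) = plan_cost {..<m} {..<m} (\<lambda>a b. dist (z a) (z b))
    (\<lambda>a b. measure L {z. c (fst z) = a \<and> c (snd z) = b})"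
    using L.integral_finite_range[OF Z K, of g]
    by (simp add: plan_cost_def g_def Z_def sum.cartesian_product case_prod_unfold prod_eq_iff)
  moreover have "\<bar>(\<integral>w. dist (fst w) (snd w) - g (Z w) \<partial>L)\<bar> \<le> (\<integral>w. 2 * e \<partial>L)"
  proof (rule order_trans[OF integral_abs_bound integral_mono])
    have igz: "integrable L (\<lambda>w. g (Z w))"
      by (rule L.integrable_finite_range[OF Z K])
    show "integrable L (\<lambda>w. \<bar>dist (fst w) (snd w) - g (Z w)\<bar>)"
      using int igz by auto
    fix w :: "'a \<times> 'a"
    obtain x y where w: "w = (x, y)" by force
    have "dist x y \<le> dist x (z (c x)) + dist (z (c x)) (z (c y)) + dist y (z (c y))"
      "dist (z (c x)) (z (c y)) \<le> dist x (z (c x)) + dist x y + dist y (z (c y))"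
      by metric+
    then show "\<bar>dist (fst w) (snd w) - g (Z w)\<bar> \<le> 2 * e"
      using c(3)[of x] c(3)[of y] by (simp add: w g_def Z_def)
  qed auto
  ultimately show ?thesis
    using int L.integrable_finite_range[OF Z K, of g] by (simp add: case_prod_unfold L.prob_space[simplified])
qed

section \<open>Bistochastic matrices and finite transport plans\<close>

text \<open>The mass at \<open>a\<close> of the empirical measure of \<open>u 1, ..., u n\<close>;
  for \<open>n = 0\<close> it is 0.\<close>

definition frequency :: "nat \<Rightarrow> (nat \<Rightarrow> 'b) \<Rightarrow> 'b \<Rightarrow> real" where
  "frequency n u a = (\<Sum>i=1..n. if u i = a then 1 else 0) / real n"

lemma frequency_nonneg: "frequency n u a \<ge> 0"
  by (auto simp: frequency_def intro!: divide_nonneg_nonneg sum_nonneg)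

text \<open>A sample average is an integral against the empirical measure, obtained by grouping the
  indices by the value of \<open>u\<close>.\<close>

lemma sum_by_frequency:
  assumes "finite K" "\<And>i. i \<in> {1..n} \<Longrightarrow> u i \<in> K"
  shows "(\<Sum>i=1..n. g (u i)) / real n = (\<Sum>a\<in>K. frequency n u a * g a)"
proof -
  have "(\<Sum>i=1..n. g (u i)) = (\<Sum>i=1..n. \<Sum>a\<in>K. if u i = a then g a else 0)"
    using assms by (intro sum.cong) auto
  also have "\<dots> = (\<Sum>a\<in>K. \<Sum>i=1..n. if u i = a then g a else 0)"
    by (rule sum.swap)
  also have "\<dots> = (\<Sum>a\<in>K. (\<Sum>i=1..n. if u i = a then 1 else 0) * g a)"
    by (intro sum.cong refl) (auto simp: sum_distrib_right intro!: sum.cong)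
  finally show ?thesis
    by (simp add: frequency_def sum_divide_distrib[symmetric] times_divide_eq_left)
qed

lemma sum_frequency:
  assumes "finite K" "\<And>i. i \<in> {1..n} \<Longrightarrow> u i \<in> K" "n > 0"
  shows "(\<Sum>a\<in>K. frequency n u a) = 1"
  using sum_by_frequency[where n = n and u = u, OF assms(1,2), where g = "\<lambda>_. 1"] assms(3) by simp

lemma bistochasticD:
  assumes "bistochastic n l"
  shows "\<And>i j. i \<in> {1..n} \<Longrightarrow> j \<in> {1..n} \<Longrightarrow> l (i, j) \<ge> 0"
    and "\<And>j. j \<in> {1..n} \<Longrightarrow> (\<Sum>i=1..n. l (i, j)) = 1"
    and "\<And>i. i \<in> {1..n} \<Longrightarrow> (\<Sum>j=1..n. l (i, j)) = 1"
  using assms unfolding bistochastic_def by auto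

abbreviation matrix_cost :: "nat \<Rightarrow> (nat \<times> nat \<Rightarrow> real) \<Rightarrow> (nat \<times> nat \<Rightarrow> real) \<Rightarrow> real" where
  "matrix_cost n r l \<equiv> 1 / real n * (\<Sum>i=1..n. \<Sum>j=1..n. l (i, j) * r (i, j))"

text \<open>A bistochastic matrix divided by \<open>n\<close> couples the uniform distribution on
  the indices with itself; its image under \<open>u\<close> and \<open>v\<close> couples the two
  empirical measures. The cost is preserved exactly because it sees only the values
  \<open>u i\<close> and \<open>v j\<close>.\<close>

lemma transport_plan_of_bistochastic:
  fixes u v :: "nat \<Rightarrow> 'b"
  assumes K: "finite K" "\<And>i. i \<in> {1..n} \<Longrightarrow> u i \<in> K" "\<And>i. i \<in> {1..n} \<Longrightarrow> v i \<in> K"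
    and l: "bistochastic n l"
  obtains \<pi> where "transport_plan K K (frequency n u) (frequency n v) \<pi>"
    "plan_cost K K d \<pi> = matrix_cost n (\<lambda>(i, j). d (u i) (v j)) l"
proof
  note l = bistochasticD[OF l]
  define \<pi> where "\<pi> a b = (\<Sum>i=1..n. \<Sum>j=1..n. if u i = a \<and> v j = b then l (i, j) / real n else 0)" for a b
  show "transport_plan K K (frequency n u) (frequency n v) \<pi>"
    unfolding transport_plan_def
  proof (intro conjI ballI)
    fix a assume a: "a \<in> K"
    have "(\<Sum>b\<in>K. \<pi> a b) = (\<Sum>i=1..n. \<Sum>j=1..n. \<Sum>b\<in>K. if u i = a \<and> v j = b then l (i, j) / real n else 0)"
      unfolding \<pi>_def by (simp only: sum.swap[of _ "{1..n}" K])
    also have "\<dots> = (\<Sum>i=1..n. \<Sum>j=1..n. if u i = a then l (i, j) / real n else 0)"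
      using K by (intro sum.cong refl) auto
    also have "\<dots> = (\<Sum>i=1..n. if u i = a then 1 / real n else 0)"
      using l(3) by (intro sum.cong refl) (auto simp: sum_divide_distrib[symmetric])
    also have "\<dots> = frequency n u a"
      by (auto simp: frequency_def sum_divide_distrib intro!: sum.cong)
    finally show "(\<Sum>b\<in>K. \<pi> a b) = frequency n u a" .
    have "(\<Sum>b\<in>K. \<pi> b a) = (\<Sum>i=1..n. \<Sum>j=1..n. \<Sum>b\<in>K. if u i = b \<and> v j = a then l (i, j) / real n else 0)"
      unfolding \<pi>_def by (simp only: sum.swap[of _ "{1..n}" K])
    also have "\<dots> = (\<Sum>i=1..n. \<Sum>j=1..n. if v j = a then l (i, j) / real n else 0)"
      using K by (intro sum.cong refl) auto
    also have "\<dots> = (\<Sum>j=1..n. \<Sum>i=1..n. if v j = a then l (i, j) / real n else 0)"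
      by (rule sum.swap)
    also have "\<dots> = (\<Sum>j=1..n. if v j = a then 1 / real n else 0)"
      using l(2) by (intro sum.cong refl) (auto simp: sum_divide_distrib[symmetric])
    also have "\<dots> = frequency n v a"
      by (auto simp: frequency_def sum_divide_distrib intro!: sum.cong)
    finally show "(\<Sum>b\<in>K. \<pi> b a) = frequency n v a" .
  next
    show "\<pi> a b \<ge> 0" for a b
      unfolding \<pi>_def using l(1) by (auto intro!: sum_nonneg)
  qed
  have "plan_cost K K d \<pi> = (\<Sum>a\<in>K. \<Sum>b\<in>K. \<Sum>i=1..n. \<Sum>j=1..n.
      if u i = a \<and> v j = b then l (i, j) / real n * d a b else 0)"
    unfolding plan_cost_def \<pi>_def sum_distrib_right by (intro sum.cong refl) auto
  also have "\<dots> = (\<Sum>i=1..n. \<Sum>j=1..n. \<Sum>a\<in>K. \<Sum>b\<in>K.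
      if u i = a \<and> v j = b then l (i, j) / real n * d a b else 0)"
    by (simp only: sum.swap[of _ "{1..n}" K])
  also have "\<dots> = (\<Sum>i=1..n. \<Sum>j=1..n. \<Sum>a\<in>K. if u i = a then l (i, j) / real n * d a (v j) else 0)"
    using K by (intro sum.cong refl) auto
  also have "\<dots> = (\<Sum>i=1..n. \<Sum>j=1..n. l (i, j) / real n * d (u i) (v j))"
    using K by (intro sum.cong refl) auto
  also have "\<dots> = matrix_cost n (\<lambda>(i, j). d (u i) (v j)) l"
    by (simp add: sum_distrib_left)
  finally show "plan_cost K K d \<pi> = matrix_cost n (\<lambda>(i, j). d (u i) (v j)) l" .
qed

text \<open>The mass \<open>\<pi> a b\<close> is spread evenly over the index pairs with
  \<open>u i = a\<close> and \<open>v j = b\<close>. In terms of the relative density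
  \<open>w\<close> the entries are \<open>w (u i) (v j) / real n\<close>, and the averages of
  \<open>w\<close> being 1 are the row and column conditions.\<close>

lemma bistochastic_of_transport_plan:
  fixes u v :: "nat \<Rightarrow> 'b"
  assumes K: "finite K" "\<And>i. i \<in> {1..n} \<Longrightarrow> u i \<in> K" "\<And>i. i \<in> {1..n} \<Longrightarrow> v i \<in> K" and n: "n > 0"
    and plan: "transport_plan K K (frequency n u) (frequency n v) \<pi>"
  obtains l where "bistochastic n l"
    "plan_cost K K d \<pi> = matrix_cost n (\<lambda>(i, j). d (u i) (v j)) l"
proof -
  obtain w where w: "\<And>i j. i \<in> K \<Longrightarrow> j \<in> K \<Longrightarrow> w i j \<ge> 0"
    "\<And>i j. i \<in> K \<Longrightarrow> j \<in> K \<Longrightarrow> frequency n u i * frequency n v j * w i j = \<pi> i j"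
    "\<And>i. i \<in> K \<Longrightarrow> (\<Sum>j\<in>K. frequency n v j * w i j) = 1"
    "\<And>j. j \<in> K \<Longrightarrow> (\<Sum>i\<in>K. frequency n u i * w i j) = 1"
    using transport_plan_relative_density[OF K(1) K(1) plan sum_frequency[OF K(1,2) n] sum_frequency[OF K(1,3) n]]
    by blast
  define l where "l = (\<lambda>(i, j). w (u i) (v j) / real n)"
  have "bistochastic n l"
    unfolding bistochastic_def
  proof (intro conjI ballI)
    show "l (i, j) \<ge> 0" if "i \<in> {1..n}" "j \<in> {1..n}" for i j
      using K w(1) that by (simp add: l_def)
    show "(\<Sum>i=1..n. l (i, j)) = 1" if "j \<in> {1..n}" for j
      using sum_by_frequency[where n = n and u = u, OF K(1,2), where g = "\<lambda>a. w a (v j)"] w(4)[OF K(3)[OF that]]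
      by (simp add: l_def sum_divide_distrib)
    show "(\<Sum>j=1..n. l (i, j)) = 1" if "i \<in> {1..n}" for i
      using sum_by_frequency[where n = n and u = v, OF K(1,3), where g = "\<lambda>b. w (u i) b"] w(3)[OF K(2)[OF that]]
      by (simp add: l_def sum_divide_distrib)
  qed
  moreover have "plan_cost K K d \<pi> = matrix_cost n (\<lambda>(i, j). d (u i) (v j)) l"
  proof -
    have "plan_cost K K d \<pi> = (\<Sum>a\<in>K. frequency n u a * (\<Sum>b\<in>K. frequency n v b * (w a b * d a b)))"
      unfolding plan_cost_def sum_distrib_left by (intro sum.cong refl) (simp add: w(2)[symmetric] mult_ac)
    also have "\<dots> = (\<Sum>a\<in>K. frequency n u a * ((\<Sum>j=1..n. w a (v j) * d a (v j)) / real n))"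
      by (simp only: sum_by_frequency[where n = n and u = v, OF K(1,3), symmetric])
    also have "\<dots> = (\<Sum>i=1..n. (\<Sum>j=1..n. w (u i) (v j) * d (u i) (v j)) / real n) / real n"
      by (rule sum_by_frequency[where n = n and u = u, OF K(1,2), symmetric])
    also have "\<dots> = matrix_cost n (\<lambda>(i, j). d (u i) (v j)) l"
      by (simp add: l_def sum_divide_distrib)
    finally show ?thesis .
  qed
  ultimately show ?thesis using that by blast
qed

section \<open>Perturbation of matrix costs and bounds for the two infima\<close>

lemma matrix_cost_approx:
  assumes l: "bistochastic n l" and n: "n > 0"
    and r: "\<And>i j. i \<in> {1..n} \<Longrightarrow> j \<in> {1..n} \<Longrightarrow> \<bar>r (i, j) - s (i, j)\<bar> \<le> e"
  shows "\<bar>matrix_cost n r l - matrix_cost n s l\<bar> \<le> e"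
proof -
  note l = bistochasticD[OF l]
  have "\<bar>(\<Sum>i=1..n. \<Sum>j=1..n. l (i, j) * r (i, j)) - (\<Sum>i=1..n. \<Sum>j=1..n. l (i, j) * s (i, j))\<bar>
      = \<bar>\<Sum>i=1..n. \<Sum>j=1..n. l (i, j) * (r (i, j) - s (i, j))\<bar>"
    by (simp add: sum_subtractf right_diff_distrib)
  also have "\<dots> \<le> (\<Sum>i=1..n. \<Sum>j=1..n. \<bar>l (i, j) * (r (i, j) - s (i, j))\<bar>)"
    by (rule order_trans[OF sum_abs sum_mono[OF sum_abs]])
  also have "\<dots> \<le> (\<Sum>i=1..n. \<Sum>j=1..n. l (i, j) * e)"
    using l(1) r by (intro sum_mono) (auto simp: abs_mult intro!: mult_left_mono)
  \<comment> \<open>Each of the \<open>n\<close> rows sums to 1; the normalisation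
    \<open>1 / real n\<close> of the cost then leaves \<open>e\<close>.\<close>
  also have "\<dots> = real n * e"
    using l(3) by (simp add: sum_distrib_right[symmetric])
  finally show ?thesis
    using n by (simp add: right_diff_distrib[symmetric] abs_mult field_simps flip: diff_divide_distrib)
qed

text \<open>This witness makes the range of the infimum nonempty.\<close>

lemma bistochastic_uniform: "n > 0 \<Longrightarrow> bistochastic n (\<lambda>_. 1 / real n)"
  by (auto simp: bistochastic_def)

text \<open>Nonnegative entries bound all costs below by 0; without such a bound a real-valued
  \<open>INF\<close> need not be a lower bound.\<close>

lemma matrix_kantorovich_inf_le:
  assumes "bistochastic n l" "\<And>i j. i \<in> {1..n} \<Longrightarrow> j \<in> {1..n} \<Longrightarrow> r (i, j) \<ge> 0"
  shows "matrix_kantorovich_inf n r \<le> matrix_cost n r l"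
  unfolding matrix_kantorovich_inf_def
proof (rule cINF_lower)
  show "bdd_below (matrix_cost n r ` {l. bistochastic n l})"
    using assms(2) bistochasticD(1)
    by (intro bdd_belowI2[of _ 0] mult_nonneg_nonneg sum_nonneg) auto
qed (use assms in auto)

lemma matrix_kantorovich_inf_greatest:
  assumes "n > 0" "\<And>l. bistochastic n l \<Longrightarrow> t \<le> matrix_cost n r l"
  shows "t \<le> matrix_kantorovich_inf n r"
  unfolding matrix_kantorovich_inf_def
  using bistochastic_uniform[OF assms(1)] assms(2) by (intro cINF_greatest) auto

lemma kantorovich_inf_le:
  assumes "L \<in> couplings M N" "\<And>z. f z \<ge> 0"
  shows "kantorovich_inf M N f \<le> integral\<^sup>L L f"
  unfolding kantorovich_inf_def
proof (rule cINF_lower)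
  show "bdd_below ((\<lambda>L. integral\<^sup>L L f) ` couplings M N)"
    using assms(2) by (intro bdd_belowI2[of _ 0]) auto
qed fact

lemma kantorovich_inf_greatest:
  assumes "couplings M N \<noteq> {}" "\<And>L. L \<in> couplings M N \<Longrightarrow> t \<le> integral\<^sup>L L f"
  shows "t \<le> kantorovich_inf M N f"
  unfolding kantorovich_inf_def using assms by (intro cINF_greatest) auto

text \<open>The comparison is deterministic; chance will enter only through the closeness of
  frequencies and cell masses. In both directions the error is \<open>2 * e\<close> for discretising
  the coupling, \<open>2 * e\<close> for discretising the matrix and
  \<open>D * (2 * real m * \<delta>)\<close> for changing the marginals.\<close>

lemma matrix_kantorovich_inf_approx:
  fixes M N :: "'a::metric_space measure" and c :: "'a \<Rightarrow> nat"
  assumes compact: "compact (UNIV :: 'a set)"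
    and M: "prob_space M" "sets M = sets borel" and N: "prob_space N" "sets N = sets borel"
    and c: "c \<in> borel \<rightarrow>\<^sub>M count_space UNIV" "\<And>x. c x < m" "\<And>x. dist x (z (c x)) < e"
    and D: "\<And>x y :: 'a. dist x y \<le> D" and n: "n > 0"
    and r: "\<And>i j. i \<in> {1..n} \<Longrightarrow> j \<in> {1..n} \<Longrightarrow> r (i, j) = dist (x i) (y j)"
    and p: "\<And>a. a < m \<Longrightarrow> \<bar>frequency n (\<lambda>i. c (x i)) a - measure M {x. c x = a}\<bar> \<le> \<delta>"
    and q: "\<And>a. a < m \<Longrightarrow> \<bar>frequency n (\<lambda>i. c (y i)) a - measure N {x. c x = a}\<bar> \<le> \<delta>"
  shows "\<bar>matrix_kantorovich_inf n r - kantorovich_inf M N (\<lambda>(x, y). dist x y)\<bar> \<le> 4 * e + D * (2 * real m * \<delta>)"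
proof -
  interpret M: prob_space M by fact
  interpret N: prob_space N by fact
  let ?K = "{..<m}" and ?d = "\<lambda>a b. dist (z a) (z b)"
  let ?p = "\<lambda>a. measure M {x. c x = a}" and ?q = "\<lambda>b. measure N {x. c x = b}"
  let ?p' = "frequency n (\<lambda>i. c (x i))" and ?q' = "frequency n (\<lambda>i. c (y i))"
  have sp [simp]: "space M = UNIV" "space N = UNIV"
    using sets_eq_imp_space_eq[OF M(2)] sets_eq_imp_space_eq[OF N(2)] by auto
  have cM: "c \<in> M \<rightarrow>\<^sub>M count_space UNIV" and cN: "c \<in> N \<rightarrow>\<^sub>M count_space UNIV"
    using c(1) by (simp_all add: measurable_cong_sets[OF M(2) refl] measurable_cong_sets[OF N(2) refl])
  have one: "sum ?p ?K = 1" "sum ?q ?K = 1"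
    using M.sum_prob_finite_range[OF cM, of ?K] N.sum_prob_finite_range[OF cN, of ?K] c(2) by auto
  have one': "sum ?p' ?K = 1" "sum ?q' ?K = 1"
    using sum_frequency[of ?K n] c(2) n by auto
  have d: "0 \<le> ?d a b \<and> ?d a b \<le> D" for a b
    using D by auto
  have r0: "r (i, j) \<ge> 0" if "i \<in> {1..n}" "j \<in> {1..n}" for i j
    using r[OF that] by simp
  let ?s = "\<lambda>(i, j). ?d (c (x i)) (c (y j))"
  have rs: "\<bar>r (i, j) - ?s (i, j)\<bar> \<le> 2 * e"
    if ij: "i \<in> {1..n}" "j \<in> {1..n}" for i j
  proof -
    have "dist (x i) (y j) \<le> dist (x i) (z (c (x i))) + ?d (c (x i)) (c (y j)) + dist (y j) (z (c (y j)))"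
      "?d (c (x i)) (c (y j)) \<le> dist (x i) (z (c (x i))) + dist (x i) (y j) + dist (y j) (z (c (y j)))"
      by metric+
    then show ?thesis
      using c(3)[of "x i"] c(3)[of "y j"] r[OF ij] by simp
  qed
  have p1: "\<bar>?p a - ?p' a\<bar> \<le> \<delta>" "\<bar>?p' a - ?p a\<bar> \<le> \<delta>" if "a \<in> ?K" for a
    using p that by (auto simp: abs_minus_commute)
  have q1: "\<bar>?q a - ?q' a\<bar> \<le> \<delta>" "\<bar>?q' a - ?q a\<bar> \<le> \<delta>" if "a \<in> ?K" for a
    using q that by (auto simp: abs_minus_commute)
  have mm: "real (card ?K + card ?K) * \<delta> = 2 * real m * \<delta>" by simp
  let ?k = "kantorovich_inf M N (\<lambda>(x, y). dist x y)" and ?E = "4 * e + D * (2 * real m * \<delta>)"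
  \<comment> \<open>Every coupling yields a bistochastic matrix that is almost as cheap: its plan
    between cell masses is moved to the frequencies and then spread over the sample.\<close>
  have upper: "matrix_kantorovich_inf n r - ?E \<le> integral\<^sup>L L (\<lambda>(x, y). dist x y)"
    if L: "L \<in> couplings M N" for L
  proof -
    let ?\<pi> = "\<lambda>a b. measure L {z. c (fst z) = a \<and> c (snd z) = b}"
    have plan: "transport_plan ?K ?K ?p ?q ?\<pi>"
      by (rule transport_plan_of_coupling[OF M(2) N(2) c(1,2) L])
    obtain \<pi>' where \<pi>': "transport_plan ?K ?K ?p' ?q' \<pi>'"
      "plan_cost ?K ?K ?d \<pi>' \<le> plan_cost ?K ?K ?d ?\<pi> + D * (real (card ?K + card ?K) * \<delta>)"
      by (rule transport_plan_change_marginals[OF _ _ plan frequency_nonneg one'(1) p1(1)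
            frequency_nonneg one'(2) q1(1) one(1) d]) auto
    obtain l where l: "bistochastic n l"
      "plan_cost ?K ?K ?d \<pi>' = matrix_cost n (\<lambda>(i, j). ?d (c (x i)) (c (y j))) l"
      by (rule bistochastic_of_transport_plan[where d = ?d, OF _ _ _ n \<pi>'(1)]) (use c(2) in auto)
    have "\<bar>matrix_cost n r l - matrix_cost n ?s l\<bar> \<le> 2 * e"
      by (rule matrix_cost_approx[OF l(1) n]) (rule rs)
    moreover have "matrix_kantorovich_inf n r \<le> matrix_cost n r l"
      by (rule matrix_kantorovich_inf_le[OF l(1)]) (rule r0)
    ultimately show ?thesis
      using coupling_cost_approx[OF compact couplingsD(1,2)[OF L] c] \<pi>'(2)[unfolded mm] l(2) by linarith
  qed
  \<comment> \<open>Conversely, a bistochastic matrix induces a plan between frequencies, which is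
    moved to the cell masses and realised by a coupling.\<close>
  have lower: "?k - ?E \<le> matrix_cost n r l" if l: "bistochastic n l" for l
  proof -
    obtain \<pi> where \<pi>: "transport_plan ?K ?K ?p' ?q' \<pi>"
      "plan_cost ?K ?K ?d \<pi> = matrix_cost n (\<lambda>(i, j). ?d (c (x i)) (c (y j))) l"
      by (rule transport_plan_of_bistochastic[where K = ?K and u = "\<lambda>i. c (x i)" and v = "\<lambda>i. c (y i)"
            and d = ?d, OF _ _ _ l]) (use c(2) in auto)
    obtain \<pi>' where \<pi>': "transport_plan ?K ?K ?p ?q \<pi>'"
      "plan_cost ?K ?K ?d \<pi>' \<le> plan_cost ?K ?K ?d \<pi> + D * (real (card ?K + card ?K) * \<delta>)"
      by (rule transport_plan_change_marginals[OF _ _ \<pi>(1) measure_nonneg one(1) p1(2)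
            measure_nonneg one(2) q1(2) one'(1) d]) auto
    obtain L where L: "L \<in> couplings M N"
      "\<And>a b. a < m \<Longrightarrow> b < m \<Longrightarrow> measure L {z. c (fst z) = a \<and> c (snd z) = b} = \<pi>' a b"
      using coupling_of_transport_plan[OF compact M N c(1,2) \<pi>'(1)] by blast
    have "plan_cost ?K ?K ?d (\<lambda>a b. measure L {z. c (fst z) = a \<and> c (snd z) = b}) = plan_cost ?K ?K ?d \<pi>'"
      unfolding plan_cost_def by (intro sum.cong refl) (simp add: L(2))
    moreover have "\<bar>matrix_cost n r l - matrix_cost n ?s l\<bar> \<le> 2 * e"
      by (rule matrix_cost_approx[OF l n]) (rule rs)
    moreover have "?k \<le> integral\<^sup>L L (\<lambda>(x, y). dist x y)"
      by (rule kantorovich_inf_le[OF L(1)]) auto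
    ultimately show ?thesis
      using coupling_cost_approx[OF compact couplingsD(1,2)[OF L(1)] c] \<pi>'(2)[unfolded mm] \<pi>(2) by linarith
  qed
  \<comment> \<open>The product plan supplies a coupling, so the infimum over couplings is a
    greatest lower bound of a nonempty set.\<close>
  have ne: "couplings M N \<noteq> {}"
  proof -
    have "transport_plan ?K ?K ?p ?q (\<lambda>a b. ?p a * ?q b)"
      using one by (simp add: transport_plan_def flip: sum_distrib_left sum_distrib_right)
    then have "\<exists>L. L \<in> couplings M N"
      using coupling_of_transport_plan[OF compact M N c(1,2)] by (meson bexE)
    then show ?thesis by auto
  qed
  have "?k - ?E \<le> matrix_kantorovich_inf n r"
    by (rule matrix_kantorovich_inf_greatest[OF n lower])
  moreover have "matrix_kantorovich_inf n r - ?E \<le> ?k"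
    by (rule kantorovich_inf_greatest[OF ne upper])
  ultimately show ?thesis by linarith
qed

section \<open>Isomorphisms and convergence in probability\<close>

lemma measurable_Pair_borel:
  fixes f g :: "'b \<Rightarrow> 'a::metric_space"
  assumes "compact (UNIV :: 'a set)" "f \<in> borel_measurable M" "g \<in> borel_measurable M"
  shows "(\<lambda>x. (f x, g x)) \<in> borel_measurable M"
  using measurable_compose[OF measurable_Pair[OF assms(2,3)] measurable_borel_prod[OF assms(1)]] .

lemma borel_measurable_dist_fst_snd:
  "(\<lambda>(x, y). dist x y) \<in> borel_measurable (borel :: ('a::metric_space \<times> 'a) measure)"
  unfolding case_prod_unfold by (intro borel_measurable_continuous_onI continuous_intros)

text \<open>Moving only the second coordinate keeps the first marginal and replaces the second by
  its image. The map \<open>g\<close> is general because both the isomorphism and its inverse will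
  take its place.\<close>

lemma couplings_map_snd:
  fixes M N P :: "'a::metric_space measure"
  assumes compact: "compact (UNIV :: 'a set)"
    and sets: "sets M = sets borel" "sets N = sets borel" "sets P = sets borel"
    and g: "g \<in> N \<rightarrow>\<^sub>M P" "distr N P g = P" and L: "L \<in> couplings M N"
  shows "distr L borel (\<lambda>z. (fst z, g (snd z))) \<in> couplings M P"
    and "(\<lambda>z. (fst z, g (snd z))) \<in> borel_measurable L"
proof -
  note L = couplingsD[OF L]
  interpret L: prob_space L by fact
  have fst: "fst \<in> L \<rightarrow>\<^sub>M M" and snd: "snd \<in> L \<rightarrow>\<^sub>M N"
    using measurable_fst_borel measurable_snd_borel
    by (simp_all add: measurable_cong_sets[OF L(2) sets(1)] measurable_cong_sets[OF L(2) sets(2)])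
  have gs: "(\<lambda>z. g (snd z)) \<in> L \<rightarrow>\<^sub>M P"
    by (rule measurable_compose[OF snd g(1)])
  show G: "(\<lambda>z. (fst z, g (snd z))) \<in> borel_measurable L"
    using fst gs by (intro measurable_Pair_borel[OF compact])
      (simp_all add: measurable_cong_sets[OF refl sets(1)] measurable_cong_sets[OF refl sets(3)])
  have fb: "fst \<in> borel \<rightarrow>\<^sub>M M" and sb: "snd \<in> borel \<rightarrow>\<^sub>M P"
    using measurable_fst_borel measurable_snd_borel
    by (simp_all add: measurable_cong_sets[OF refl sets(1)] measurable_cong_sets[OF refl sets(3)])
  show "distr L borel (\<lambda>z. (fst z, g (snd z))) \<in> couplings M P"
    unfolding couplings_def
  proof (intro CollectI conjI)
    show "prob_space (distr L borel (\<lambda>z. (fst z, g (snd z))))"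
      by (rule L.prob_space_distr[OF G])
    show "distr (distr L borel (\<lambda>z. (fst z, g (snd z)))) M fst = M"
      using L(4) by (simp add: distr_distr[OF fb G] comp_def)
    have "distr (distr L borel (\<lambda>z. (fst z, g (snd z)))) P snd = distr (distr L N snd) P g"
      by (simp add: distr_distr[OF sb G] distr_distr[OF g(1) snd] comp_def)
    then show "distr (distr L borel (\<lambda>z. (fst z, g (snd z)))) P snd = P"
      using L(5) g(2) by simp
  qed simp
qed

text \<open>The inverse on the full-measure set \<open>B\<close> is extended by a constant to a
  total measurable map. It preserves measure because \<open>T (S x) = x\<close> almost everywhere
  and \<open>S\<close> carries \<open>M\<close> to \<open>N\<close>.\<close>

lemma mod0_isomorphism_inverse:
  assumes S: "mod0_isomorphism M N S" and "space M \<noteq> {}"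
  obtains T where "T \<in> N \<rightarrow>\<^sub>M M" "distr N M T = M" "AE y in N. S (T y) = y"
proof -
  obtain A B where AB: "A \<in> sets M" "B \<in> sets N" "space M - A \<in> null_sets M" "space N - B \<in> null_sets N"
    "bij_betw S A B" "the_inv_into A S \<in> restrict_space N B \<rightarrow>\<^sub>M restrict_space M A"
    and Sm: "S \<in> M \<rightarrow>\<^sub>M N" "distr M N S = N"
    using S unfolding mod0_isomorphism_def by auto
  obtain x0 where x0: "x0 \<in> space M" using assms(2) by auto
  define T where "T y = (if y \<in> B then the_inv_into A S y else x0)" for y
  have inv: "the_inv_into A S \<in> restrict_space N B \<rightarrow>\<^sub>M M"
    using AB(6) by (simp add: measurable_restrict_space2_iff)
  have T: "T \<in> N \<rightarrow>\<^sub>M M"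
    unfolding T_def
  proof (subst measurable_If_restrict_space_iff)
    show "{x \<in> space N. x \<in> B} \<in> sets N"
      using AB(2) by measurable
    show "the_inv_into A S \<in> restrict_space N {x. x \<in> B} \<rightarrow>\<^sub>M M \<and>
        (\<lambda>x. x0) \<in> restrict_space N {x. x \<notin> B} \<rightarrow>\<^sub>M M"
      using inv x0 by simp
  qed
  have "AE y in N. y \<in> B"
    by (rule AE_I'[OF AB(4)]) auto
  then have "AE y in N. S (T y) = y"
    by eventually_elim (use AB(5) in \<open>auto simp: T_def bij_betw_def intro: f_the_inv_into_f\<close>)
  moreover have "AE x in M. x \<in> A"
    by (rule AE_I'[OF AB(3)]) auto
  then have "AE x in M. T (S x) = x"
    by eventually_elim (use AB(5) in \<open>auto simp: T_def bij_betw_def the_inv_into_f_f\<close>)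
  then have "distr M M (\<lambda>x. T (S x)) = distr M M (\<lambda>x. x)"
    by (intro distr_cong_AE refl measurable_compose[OF Sm(1) T]) auto
  then have "distr N M T = M"
    using distr_distr[OF T Sm(1)] Sm(2) by (simp add: comp_def distr_id)
  ultimately show ?thesis using T that by blast
qed

text \<open>Moving the second coordinate by \<open>S\<close>, or back by an almost everywhere
  inverse \<open>T\<close>, takes each class of couplings into the other without changing the cost.
  The two sets of costs coincide, and with them their infima.\<close>

lemma kantorovich_inf_shifted_metric:
  fixes M N :: "'a::metric_space measure"
  assumes compact: "compact (UNIV :: 'a set)"
    and sets: "sets M = sets borel" "sets N = sets borel"
    and S: "mod0_isomorphism M N S"
  shows "kantorovich_inf M M (shifted_metric S) = kantorovich_inf M N (\<lambda>(x, y). dist x y)"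
proof -
  have Sm: "S \<in> M \<rightarrow>\<^sub>M N" "distr M N S = N"
    using S unfolding mod0_isomorphism_def by auto
  have "space M \<noteq> {}"
    using sets_eq_imp_space_eq[OF sets(1)] by simp
  from mod0_isomorphism_inverse[OF S this] obtain T
    where T: "T \<in> N \<rightarrow>\<^sub>M M" "distr N M T = M" and ST: "AE y in N. S (T y) = y" .
  have dist_m: "(\<lambda>z. dist (fst z) (snd z)) \<in> borel_measurable (borel :: ('a \<times> 'a) measure)"
    using borel_measurable_dist_fst_snd by (simp add: case_prod_unfold)
  have Sb: "S \<in> borel_measurable borel"
    using Sm(1) by (simp add: measurable_cong_sets[OF sets])
  have shift_m: "(\<lambda>z. dist (fst z) (S (snd z))) \<in> borel_measurable (borel :: ('a \<times> 'a) measure)"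
    using measurable_compose[OF measurable_Pair_borel[OF compact measurable_fst_borel
          measurable_compose[OF measurable_snd_borel Sb]] dist_m] by simp
  have "(\<lambda>L. integral\<^sup>L L (shifted_metric S)) ` couplings M M
      = (\<lambda>L. integral\<^sup>L L (\<lambda>(x, y). dist x y)) ` couplings M N"
  proof (intro equalityI image_subsetI)
    fix L assume L: "L \<in> couplings M M"
    note L' = couplings_map_snd[OF compact sets(1,1,2) Sm L]
    have "integral\<^sup>L L (shifted_metric S)
        = integral\<^sup>L (distr L borel (\<lambda>z. (fst z, S (snd z)))) (\<lambda>(x, y). dist x y)"
      by (simp add: integral_distr[OF L'(2)] dist_m shifted_metric_def case_prod_unfold)
    with L'(1) show "integral\<^sup>L L (shifted_metric S) \<in> (\<lambda>L. integral\<^sup>L L (\<lambda>(x, y). dist x y)) ` couplings M N"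
      by blast
  next
    fix L assume L: "L \<in> couplings M N"
    note L' = couplings_map_snd[OF compact sets(1,2,1) T L]
    have snd: "snd \<in> L \<rightarrow>\<^sub>M N"
      using measurable_snd_borel by (simp add: measurable_cong_sets[OF couplingsD(2)[OF L] sets(2)])
    \<comment> \<open>The second marginal of \<open>L\<close> is \<open>N\<close>, so the almost
      everywhere identity for \<open>S\<close> and \<open>T\<close> lifts to
      \<open>L\<close>.\<close>
    have AE: "AE z in L. S (T (snd z)) = snd z"
      using AE_distrD[OF snd, of "\<lambda>y. S (T y) = y"] ST by (simp only: couplingsD(5)[OF L])
    have dm: "(\<lambda>z. dist (fst z) (snd z)) \<in> borel_measurable L"
      using dist_m by (simp add: measurable_cong_sets[OF couplingsD(2)[OF L] refl])
    have "integral\<^sup>L L (\<lambda>(x, y). dist x y) = (\<integral>z. dist (fst z) (S (T (snd z))) \<partial>L)"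
      unfolding case_prod_unfold
    proof (rule integral_cong_AE)
      show "(\<lambda>z. dist (fst z) (S (T (snd z)))) \<in> borel_measurable L"
        using measurable_compose[OF L'(2) shift_m] by simp
    qed (use dm AE in auto)
    also have "\<dots> = integral\<^sup>L (distr L borel (\<lambda>z. (fst z, T (snd z)))) (shifted_metric S)"
      by (simp add: integral_distr[OF L'(2)] shift_m shifted_metric_def case_prod_unfold)
    finally show "integral\<^sup>L L (\<lambda>(x, y). dist x y) \<in> (\<lambda>L. integral\<^sup>L L (shifted_metric S)) ` couplings M M"
      using L'(1) by blast
  qed
  then show ?thesis
    unfolding kantorovich_inf_def by simp
qed

text \<open>
  A set outside \<open>sets N\<close> has junk measure 0. This avoids showing that the uncountable infimum over
  bistochastic matrices is measurable.
\<close>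
lemma measure_distr_le:
  assumes "finite_measure M" "f \<in> M \<rightarrow>\<^sub>M N" "B \<in> sets M" "f -` A \<inter> space M \<subseteq> B"
  shows "measure (distr M N f) A \<le> measure M B"
proof (cases "A \<in> sets N")
  case True
  then show ?thesis
    using assms by (simp add: measure_distr finite_measure.finite_measure_mono)
next
  case False
  then show ?thesis by (simp add: measure_notin_sets)
qed

section \<open>Convergence in probability of the empirical transport cost\<close>

theorem theorem5:
  fixes \<mu>\<^sub>1 \<mu>\<^sub>2 :: "'a::metric_space measure" and S :: "'a \<Rightarrow> 'a" and k :: real
  assumes "compact (UNIV :: 'a set)"
    and "prob_space \<mu>\<^sub>1" and "sets \<mu>\<^sub>1 = sets borel" and "\<And>x. emeasure \<mu>\<^sub>1 {x} = 0"
    and "prob_space \<mu>\<^sub>2" and "sets \<mu>\<^sub>2 = sets borel" and "\<And>x. emeasure \<mu>\<^sub>2 {x} = 0"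
    and "mod0_isomorphism \<mu>\<^sub>1 \<mu>\<^sub>2 S"
    and "k = kantorovich_inf \<mu>\<^sub>1 \<mu>\<^sub>1 (shifted_metric S)"
  shows "k = kantorovich_inf \<mu>\<^sub>1 \<mu>\<^sub>2 (\<lambda>(x, y). dist x y) \<and>
         (\<forall>\<epsilon>>0.
           (\<lambda>n. measure (symmetric_matrix_distribution \<mu>\<^sub>1 (shifted_metric S))
                  {r \<in> space infinite_matrices. \<bar>matrix_kantorovich_inf n r - k\<bar> > \<epsilon>})
             \<longlonglongrightarrow> 0)"
proof (intro conjI allI impI)
  note compact = assms(1) and P1 = assms(2) and s1 = assms(3) and P2 = assms(5) and s2 = assms(6) and S = assms(8)
  show k: "k = kantorovich_inf \<mu>\<^sub>1 \<mu>\<^sub>2 (\<lambda>(x, y). dist x y)"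
    using kantorovich_inf_shifted_metric[OF compact s1 s2 S] assms(9) by simp
  fix \<epsilon> :: real assume \<epsilon>: "\<epsilon> > 0"
  have Sm: "S \<in> \<mu>\<^sub>1 \<rightarrow>\<^sub>M \<mu>\<^sub>2" and S\<mu>: "distr \<mu>\<^sub>1 \<mu>\<^sub>2 S = \<mu>\<^sub>2"
    using S unfolding mod0_isomorphism_def by auto
  have [simp]: "space \<mu>\<^sub>1 = UNIV" "space \<mu>\<^sub>2 = UNIV"
    using sets_eq_imp_space_eq[OF s1] sets_eq_imp_space_eq[OF s2] by auto
  \<comment> \<open>With cell radius \<open>\<epsilon> / 8\<close> the discretisation error
    \<open>4 * (\<epsilon> / 8)\<close> uses half of \<open>\<epsilon>\<close>.\<close>
  have "\<epsilon> / 8 > 0" using \<epsilon> by simp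
  then obtain m :: nat and c :: "'a \<Rightarrow> nat" and z :: "nat \<Rightarrow> 'a"
    where c: "c \<in> borel \<rightarrow>\<^sub>M count_space UNIV" "\<forall>x. c x < m" "\<forall>x. dist x (z (c x)) < \<epsilon> / 8"
    by (rule finite_borel_classification[OF compact])
  note c = c(1) c(2,3)[rule_format]
  obtain D where D: "\<And>x y :: 'a. dist x y \<le> D"
    using compact_imp_bounded[OF compact] unfolding bounded_two_points by auto
  have D0: "D \<ge> 0"
    using D[of undefined undefined] by simp
  \<comment> \<open>This choice keeps \<open>D * (2 * real m * \<delta>)\<close> below the other
    half of \<open>\<epsilon>\<close>; the summand 1 keeps the denominator positive when
    \<open>D = 0\<close>.\<close>
  define \<delta> where "\<delta> = \<epsilon> / (4 * (D * real m + 1))"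
  have pos: "D * real m + 1 > 0"
    using D0 by (simp add: add_nonneg_pos)
  have \<delta>: "\<delta> > 0"
    using \<epsilon> pos by (simp add: \<delta>_def)
  have small: "4 * (\<epsilon> / 8) + D * (2 * real m * \<delta>) \<le> \<epsilon>"
  proof -
    have "\<epsilon> / (4 * w) * w = \<epsilon> / 4" if "w > 0" for w :: real
      using that by simp
    from this[OF pos] have "\<delta> * (D * real m + 1) = \<epsilon> / 4"
      unfolding \<delta>_def .
    then have "\<delta> * (D * real m) \<le> \<epsilon> / 4"
      using \<delta> by (simp add: distrib_left)
    then show ?thesis by (simp add: mult_ac)
  qed
  define E1 where "E1 a = {x. c x = a}" for a
  \<comment> \<open>Pulling the cells back by \<open>S\<close> turns the frequencies of
    \<open>S (x i)\<close> into frequencies of the same i.i.d. sample with law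
    \<open>\<mu>\<^sub>1\<close>; the mass of \<open>E2 a\<close> is the
    \<open>\<mu>\<^sub>2\<close>-mass of cell \<open>a\<close>.\<close>
  define E2 where "E2 a = {x. c (S x) = a}" for a
  let ?P = "PiM {1..} (\<lambda>_::nat. \<mu>\<^sub>1)"
  interpret P: prob_space ?P
    using P1 by (intro prob_space_PiM)
  have Eb: "E1 a \<in> sets borel" for a
    using measurable_sets[OF c(1), of "{a}"] by (simp add: E1_def vimage_def)
  have E1: "E1 a \<in> sets \<mu>\<^sub>1" and E1': "E1 a \<in> sets \<mu>\<^sub>2" for a
    using Eb s1 s2 by auto
  have E2: "E2 a \<in> sets \<mu>\<^sub>1" for a
    using measurable_sets[OF Sm E1'] by (simp add: E1_def E2_def vimage_def)
  have \<mu>2: "measure \<mu>\<^sub>2 {x. c x = a} = measure \<mu>\<^sub>1 (E2 a)" for a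
    using measure_distr[OF Sm E1'[of a]] by (simp add: S\<mu> E1_def E2_def vimage_def)
  define bad where "bad E n = {x \<in> space ?P. \<bar>(\<Sum>i=1..n. indicator E (x i)) / real n - measure \<mu>\<^sub>1 E\<bar> \<ge> \<delta>}"
    for E :: "'a set" and n
  have bad_sets: "bad E n \<in> sets ?P" if "E \<in> sets \<mu>\<^sub>1" for E n
  proof -
    have [measurable]: "E \<in> sets \<mu>\<^sub>1" by fact
    have [measurable]: "(\<lambda>x. \<Sum>i=1..n. indicator E (x i) :: real) \<in> borel_measurable ?P"
      by (intro borel_measurable_sum measurable_compose[OF measurable_component_singleton]) auto
    show ?thesis unfolding bad_def by measurable
  qed
  have bad_lim: "(\<lambda>n. P.prob (bad E n)) \<longlonglongrightarrow> 0" if "E \<in> sets \<mu>\<^sub>1" for E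
    unfolding bad_def by (rule frequency_tendsto_in_probability[OF P1 that \<delta>])
  \<comment> \<open>The number \<open>m\<close> of cells is fixed while \<open>n\<close> grows, so
    subadditivity controls this union, whatever the dependence between the frequencies of
    \<open>x i\<close> and of \<open>S (x i)\<close>.\<close>
  define Bad where "Bad n = (\<Union>a<m. bad (E1 a) n \<union> bad (E2 a) n)" for n
  have Bad_sets: "Bad n \<in> sets ?P" for n
    unfolding Bad_def using E1 E2 by (intro sets.finite_UN sets.Un bad_sets) auto
  have Bad_le: "P.prob (Bad n) \<le> (\<Sum>a<m. P.prob (bad (E1 a) n) + P.prob (bad (E2 a) n))" for n
  proof -
    have "P.prob (Bad n) \<le> (\<Sum>a<m. P.prob (bad (E1 a) n \<union> bad (E2 a) n))"
      unfolding Bad_def using E1 E2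
      by (intro P.finite_measure_subadditive_finite image_subsetI sets.Un bad_sets) simp_all
    also have "\<dots> \<le> (\<Sum>a<m. P.prob (bad (E1 a) n) + P.prob (bad (E2 a) n))"
      using E1 E2 by (intro sum_mono measure_Un_le bad_sets)
    finally show ?thesis .
  qed
  let ?F = "\<lambda>x. restrict (\<lambda>(i, j). shifted_metric S (x i, x j)) ({1..} \<times> {1..})"
  \<comment> \<open>Off \<open>Bad n\<close> the deterministic comparison applies with second sample
    \<open>S (x j)\<close>, since the matrix entries are
    \<open>dist (x i) (S (x j))\<close>.\<close>
  have good: "\<bar>matrix_kantorovich_inf n (?F x) - k\<bar> \<le> \<epsilon>"
    if n: "n > 0" and x: "x \<in> space ?P" "x \<notin> Bad n" for n x
  proof -
    have fr: "frequency n (\<lambda>i. c (x i)) a = (\<Sum>i=1..n. indicator (E1 a) (x i)) / real n"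
      "frequency n (\<lambda>i. c (S (x i))) a = (\<Sum>i=1..n. indicator (E2 a) (x i)) / real n" for a
      unfolding frequency_def E1_def E2_def
      by (intro arg_cong2[where f = "(/)"] sum.cong refl, simp)+
    have close: "\<bar>frequency n (\<lambda>i. c (x i)) a - measure \<mu>\<^sub>1 {x. c x = a}\<bar> \<le> \<delta>"
      "\<bar>frequency n (\<lambda>i. c (S (x i))) a - measure \<mu>\<^sub>2 {x. c x = a}\<bar> \<le> \<delta>" if "a < m" for a
      using x that unfolding fr \<mu>2 by (force simp: Bad_def bad_def E1_def)+
    have "\<bar>matrix_kantorovich_inf n (?F x) - k\<bar> \<le> 4 * (\<epsilon> / 8) + D * (2 * real m * \<delta>)"
      unfolding k
      by (rule matrix_kantorovich_inf_approx[OF compact P1 s1 P2 s2 c D n _ close])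
        (auto simp: shifted_metric_def)
    with small show ?thesis by linarith
  qed
  have F: "?F \<in> ?P \<rightarrow>\<^sub>M infinite_matrices"
    unfolding infinite_matrices_def
  proof (rule measurable_restrict)
    fix ij :: "nat \<times> nat" assume ij: "ij \<in> {1..} \<times> {1..}"
    have "(\<lambda>x. x (fst ij)) \<in> ?P \<rightarrow>\<^sub>M \<mu>\<^sub>1" "(\<lambda>x. x (snd ij)) \<in> ?P \<rightarrow>\<^sub>M \<mu>\<^sub>1"
      using ij by (auto intro!: measurable_component_singleton)
    then have "(\<lambda>x. x (fst ij)) \<in> borel_measurable ?P" "(\<lambda>x. S (x (snd ij))) \<in> borel_measurable ?P"
      using measurable_compose[OF _ Sm, of "\<lambda>x. x (snd ij)" ?P]
      by (auto simp: measurable_cong_sets[OF refl s1] measurable_cong_sets[OF refl s2])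
    from measurable_compose[OF measurable_Pair_borel[OF compact this] borel_measurable_dist_fst_snd]
    show "(\<lambda>x. case ij of (i, j) \<Rightarrow> shifted_metric S (x i, x j)) \<in> borel_measurable ?P"
      by (simp add: shifted_metric_def case_prod_unfold)
  qed
  let ?X = "\<lambda>n. {r \<in> space infinite_matrices. \<bar>matrix_kantorovich_inf n r - k\<bar> > \<epsilon>}"
  have bound: "measure (symmetric_matrix_distribution \<mu>\<^sub>1 (shifted_metric S)) (?X n)
      \<le> (\<Sum>a<m. P.prob (bad (E1 a) n) + P.prob (bad (E2 a) n))" if n: "n > 0" for n
  proof -
    have "measure (symmetric_matrix_distribution \<mu>\<^sub>1 (shifted_metric S)) (?X n) \<le> P.prob (Bad n)"
      unfolding symmetric_matrix_distribution_def
    proof (rule measure_distr_le[OF P.finite_measure_axioms F Bad_sets])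
      show "?F -` ?X n \<inter> space ?P \<subseteq> Bad n"
        using good[OF n] by (force simp: not_le[symmetric])
    qed
    with Bad_le[of n] show ?thesis by linarith
  qed
  have "(\<lambda>n. \<Sum>a<m. P.prob (bad (E1 a) n) + P.prob (bad (E2 a) n)) \<longlonglongrightarrow> (\<Sum>a<m. 0 + 0)"
    using E1 E2 by (intro tendsto_sum tendsto_add bad_lim)
  then have "(\<lambda>n. \<Sum>a<m. P.prob (bad (E1 a) n) + P.prob (bad (E2 a) n)) \<longlonglongrightarrow> 0"
    by simp
  then show "(\<lambda>n. measure (symmetric_matrix_distribution \<mu>\<^sub>1 (shifted_metric S)) (?X n)) \<longlonglongrightarrow> 0"
  proof (rule Lim_null_comparison[rotated])
    show "\<forall>\<^sub>F n in sequentially. norm (measure (symmetric_matrix_distribution \<mu>\<^sub>1 (shifted_metric S)) (?X n))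
        \<le> (\<Sum>a<m. P.prob (bad (E1 a) n) + P.prob (bad (E2 a) n))"
      using bound by (intro eventually_mono[OF eventually_gt_at_top[of 0]]) auto
  qed
qed

end
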